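(* Assume (H$_1$)–(H$_3$) (listed in the context), let $\mathcal O_W,f^1,\overline G,C,Q$ be as in the context, and let $\mathcal S=-\rho s-\tfrac43\eta^{3/4}$, viewed as a function of $W\in\mathcal O_W$. Let $\overline W\in\mathcal O_W$ be a constant equilibrium state, i.e. $\overline\eta=\overline\theta^4$. Then the Hessian of $\mathcal S$ is a symmetrizer for the linearization of the system $$W_t+f^1(W)_x=(\overline GW_x)_x+C(W)W_x+Q(W)$$ around $\overline W$, through the change of variables $Z=D_W^2\mathcal S(\overline W)\,(W-\overline W)$. That is, in the variable $Z$ the linearized system is $$\widetilde A^0Z_t+\widetilde A^1Z_x+\widetilde LZ=\widetilde BZ_{xx},$$ $$\widetilde A^0=D_W^2\mathcal S(\overline W)^{-1},\quad\widetilde A^1=(D_Wf^1(\overline W)-C(\overline W))D_W^2\mathcal S(\overline W)^{-1},$$ $$\widetilde L=-D_WQ(\overline W)D_W^2\mathcal S(\overline W)^{-1},\quad\widetilde B=\overline G\,D_W^2\mathcal S(\overline W)^{-1},$$ where $\widetilde A^0$ is symmetric positive definite, $\widetilde A^1$ is symmetric, and $\widetilde L$, $\widetilde B$ are symmetric positive semi-definite.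
   Context: Variables: $V=(\rho,u,\theta,\eta)$ with $\rho,\theta,\eta>0$, $u\in\mathbb{R}$, and $W=(\rho,m,\mathcal E,\eta)$ with $m=\rho u$, $\mathcal E=\rho(e(\rho,\theta)+u^2/2)$. Since $e_\theta>0$, $V\mapsto W$ is a diffeomorphism of $\{\rho>0,u\in\mathbb{R},\theta>0,\eta>0\}$ onto its image $\mathcal O_W\subset\mathbb{R}^4$; $u,\theta,p,e,s$ are regarded as functions of $W$ through its inverse. Put $$f^1(W)=\begin{pmatrix}\rho u\\ \rho u^2+p+\tfrac13\eta\\ \mathcal Eu+(p+\tfrac13\eta)u\\ \eta u\end{pmatrix},\quad Q(W)=\begin{pmatrix}0\\0\\ \sigma_a(\eta-\theta^4)\\-\sigma_a(\eta-\theta^4)\end{pmatrix},$$ $$C(W)=\begin{pmatrix}0&0&0&0\\0&0&0&0\\-\frac{u\eta}{3\rho}&\frac{\eta}{3\rho}&0&0\\ \frac{u\eta}{3\rho}&-\frac{\eta}{3\rho}&0&0\end{pmatrix},\quad \overline G=\mathrm{diag}\big(0,0,0,\tfrac1{3\sigma_s}\big).$$ Assumptions: (H$_1$) the independent thermodynamic variables $(\rho,\theta)$ take values in $\mathcal D=\{\rho>0,\theta>0\}$. (H$_2$) the pressure $p$, internal energy $e$ and specific entropy $s$ of the fluid are $C^\infty$ functions on $\mathcal D$ with $p>0$, $p_\rho>0$, $p_\theta>0$, $e_\theta>0$, satisfying $de=\theta\,ds-p\,d(1/\rho)$, i.e. $e_\rho=(p-\theta p_\theta)/\rho^2$, $s_\rho=-p_\theta/\rho^2$,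 $s_\theta=e_\theta/\theta$. (H$_3$) $\sigma_a,\sigma_s$ are positive constants. *)

theory Defs
  imports "HOL-Analysis.Analysis"
begin

section \<open>Calculus and matrices\<close>

(* The functions below are only used on open sets S, where the unrestricted
   Frechet derivative at a point of S depends on the values on S alone. *)
primrec Ck_on :: "nat \<Rightarrow> ('a::euclidean_space \<Rightarrow> 'b::real_normed_vector) \<Rightarrow> 'a set \<Rightarrow> bool" where
  "Ck_on 0 f S \<longleftrightarrow> continuous_on S f"
| "Ck_on (Suc k) f S \<longleftrightarrow>
     (\<forall>x\<in>S. f differentiable (at x)) \<and>
     (\<forall>b\<in>Basis. Ck_on k (\<lambda>x. frechet_derivative f (at x) b) S)"

definition C_infinity_on :: "('a::euclidean_space \<Rightarrow> 'b::real_normed_vector) \<Rightarrow> 'a set \<Rightarrow> bool" where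
  "C_infinity_on f S \<longleftrightarrow> (\<forall>k. Ck_on k f S)"

definition gradient :: "(real ^ 'n \<Rightarrow> real) \<Rightarrow> real ^ 'n \<Rightarrow> real ^ 'n" where
  "gradient f x = (\<chi> i. frechet_derivative f (at x) (axis i 1))"

definition hessian :: "(real ^ 'n \<Rightarrow> real) \<Rightarrow> real ^ 'n \<Rightarrow> real ^ 'n ^ 'n" where
  "hessian f x = jacobian (gradient f) (at x)"

definition sym_pos_def :: "real ^ 'n ^ 'n \<Rightarrow> bool" where
  "sym_pos_def A \<longleftrightarrow> transpose A = A \<and> (\<forall>x. x \<noteq> 0 \<longrightarrow> x \<bullet> (A *v x) > 0)"

definition sym_pos_semidef :: "real ^ 'n ^ 'n \<Rightarrow> bool" where
  "sym_pos_semidef A \<longleftrightarrow> transpose A = A \<and> (\<forall>x. x \<bullet> (A *v x) \<ge> 0)"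

lemma vector_4 [simp]:
  "(vector [a, b, c, d] :: 'a::zero ^ 4) $ 1 = a"
  "(vector [a, b, c, d] :: 'a::zero ^ 4) $ 2 = b"
  "(vector [a, b, c, d] :: 'a::zero ^ 4) $ 3 = c"
  "(vector [a, b, c, d] :: 'a::zero ^ 4) $ 4 = d"
  by (simp_all add: vector_def)

section \<open>Systems of balance laws in one space dimension and their linearization\<close>

text \<open>Fields are functions of time \<open>t\<close> and position \<open>x\<close>, in this order.\<close>

definition Dt :: "(real \<Rightarrow> real \<Rightarrow> 'a::real_normed_vector) \<Rightarrow> real \<Rightarrow> real \<Rightarrow> 'a" where
  "Dt W t x = vector_derivative (\<lambda>\<tau>. W \<tau> x) (at t)"

definition Dx :: "(real \<Rightarrow> real \<Rightarrow> 'a::real_normed_vector) \<Rightarrow> real \<Rightarrow> real \<Rightarrow> 'a" where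
  "Dx W t x = vector_derivative (\<lambda>\<xi>. W t \<xi>) (at x)"

text \<open>The system \<open>W\<^sub>t + f(W)\<^sub>x = (G W\<^sub>x)\<^sub>x + C(W) W\<^sub>x + Q(W)\<close> is the equation \<open>system_residual f G C Q W = 0\<close>.\<close>

definition system_residual ::
  "(real ^ 'n \<Rightarrow> real ^ 'n) \<Rightarrow> real ^ 'n ^ 'n \<Rightarrow> (real ^ 'n \<Rightarrow> real ^ 'n ^ 'n) \<Rightarrow> (real ^ 'n \<Rightarrow> real ^ 'n) \<Rightarrow>
   (real \<Rightarrow> real \<Rightarrow> real ^ 'n) \<Rightarrow> real \<Rightarrow> real \<Rightarrow> real ^ 'n" where
  "system_residual f G C Q W t x =
     Dt W t x + Dx (\<lambda>t x. f (W t x)) t x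
     - (Dx (\<lambda>t x. G *v Dx W t x) t x + C (W t x) *v Dx W t x + Q (W t x))"

text \<open>The linearization of an operator \<open>F\<close> around the constant state \<open>Wb\<close> is its directional
  derivative there; \<open>R\<close> is its value at the perturbation \<open>U\<close> and the point \<open>(t, x)\<close>.\<close>

definition linearization_value ::
  "((real \<Rightarrow> real \<Rightarrow> real ^ 'n) \<Rightarrow> real \<Rightarrow> real \<Rightarrow> real ^ 'n) \<Rightarrow> real ^ 'n \<Rightarrow>
   (real \<Rightarrow> real \<Rightarrow> real ^ 'n) \<Rightarrow> real \<Rightarrow> real \<Rightarrow> real ^ 'n \<Rightarrow> bool" where
  "linearization_value F Wb U t x R \<longleftrightarrow>
     ((\<lambda>\<epsilon>. F (\<lambda>t x. Wb + \<epsilon> *\<^sub>R U t x) t x) has_vector_derivative R) (at 0)"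

section \<open>The radiation hydrodynamics system\<close>

text \<open>The thermodynamic functions \<open>e\<close>, \<open>p\<close>, \<open>s\<close> take the arguments \<open>\<rho>\<close>, \<open>\<theta>\<close>, in this order.
  The components of a primitive state are \<open>V = (\<rho>, u, \<theta>, \<eta>)\<close>, those of a conservative state
  \<open>W = (\<rho>, m, E, \<eta>)\<close>.\<close>

definition thermo_domain :: "(real \<times> real) set" where
  "thermo_domain = {0<..} \<times> {0<..}"

definition D_rho :: "(real \<Rightarrow> real \<Rightarrow> real) \<Rightarrow> real \<Rightarrow> real \<Rightarrow> real" where
  "D_rho g \<rho> \<theta> = deriv (\<lambda>r. g r \<theta>) \<rho>"

definition D_theta :: "(real \<Rightarrow> real \<Rightarrow> real) \<Rightarrow> real \<Rightarrow> real \<Rightarrow> real" where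
  "D_theta g \<rho> \<theta> = deriv (\<lambda>h. g \<rho> h) \<theta>"

definition prim_domain :: "(real ^ 4) set" where
  "prim_domain = {V. V $ 1 > 0 \<and> V $ 3 > 0 \<and> V $ 4 > 0}"

definition cons_of_prim :: "(real \<Rightarrow> real \<Rightarrow> real) \<Rightarrow> real ^ 4 \<Rightarrow> real ^ 4" where
  "cons_of_prim e V =
     (let \<rho> = V $ 1; u = V $ 2; \<theta> = V $ 3; \<eta> = V $ 4
      in vector [\<rho>, \<rho> * u, \<rho> * (e \<rho> \<theta> + u\<^sup>2 / 2), \<eta>])"

definition cons_domain :: "(real \<Rightarrow> real \<Rightarrow> real) \<Rightarrow> (real ^ 4) set" where
  "cons_domain e = cons_of_prim e ` prim_domain"

definition prim_of_cons :: "(real \<Rightarrow> real \<Rightarrow> real) \<Rightarrow> real ^ 4 \<Rightarrow> real ^ 4" where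
  "prim_of_cons e = inv_into prim_domain (cons_of_prim e)"

definition velocity :: "(real \<Rightarrow> real \<Rightarrow> real) \<Rightarrow> real ^ 4 \<Rightarrow> real" where
  "velocity e W = prim_of_cons e W $ 2"

definition temperature :: "(real \<Rightarrow> real \<Rightarrow> real) \<Rightarrow> real ^ 4 \<Rightarrow> real" where
  "temperature e W = prim_of_cons e W $ 3"

definition flux :: "(real \<Rightarrow> real \<Rightarrow> real) \<Rightarrow> (real \<Rightarrow> real \<Rightarrow> real) \<Rightarrow> real ^ 4 \<Rightarrow> real ^ 4" where
  "flux e p W =
     (let \<rho> = W $ 1; E = W $ 3; \<eta> = W $ 4; u = velocity e W; \<theta> = temperature e W
      in vector [\<rho> * u,
                 \<rho> * u\<^sup>2 + p \<rho> \<theta> + \<eta> / 3,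
                 E * u + (p \<rho> \<theta> + \<eta> / 3) * u,
                 \<eta> * u])"

definition source :: "(real \<Rightarrow> real \<Rightarrow> real) \<Rightarrow> real \<Rightarrow> real ^ 4 \<Rightarrow> real ^ 4" where
  "source e \<sigma>a W =
     (let \<eta> = W $ 4; \<theta> = temperature e W
      in vector [0, 0, \<sigma>a * (\<eta> - \<theta> ^ 4), - \<sigma>a * (\<eta> - \<theta> ^ 4)])"

definition noncons_matrix :: "(real \<Rightarrow> real \<Rightarrow> real) \<Rightarrow> real ^ 4 \<Rightarrow> real ^ 4 ^ 4" where
  "noncons_matrix e W =
     (let \<rho> = W $ 1; \<eta> = W $ 4; u = velocity e W
      in vector [vector [0, 0, 0, 0],
                 vector [0, 0, 0, 0],
                 vector [- (u * \<eta> / (3 * \<rho>)), \<eta> / (3 * \<rho>), 0, 0],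
                 vector [u * \<eta> / (3 * \<rho>), - (\<eta> / (3 * \<rho>)), 0, 0]])"

definition diffusion_matrix :: "real \<Rightarrow> real ^ 4 ^ 4" where
  "diffusion_matrix \<sigma>s =
     vector [vector [0, 0, 0, 0],
             vector [0, 0, 0, 0],
             vector [0, 0, 0, 0],
             vector [0, 0, 0, 1 / (3 * \<sigma>s)]]"

definition entropy_fun :: "(real \<Rightarrow> real \<Rightarrow> real) \<Rightarrow> (real \<Rightarrow> real \<Rightarrow> real) \<Rightarrow> real ^ 4 \<Rightarrow> real" where
  "entropy_fun e s W =
     (let \<rho> = W $ 1; \<eta> = W $ 4; \<theta> = temperature e W
      in - \<rho> * s \<rho> \<theta> - 4 / 3 * \<eta> powr (3 / 4))"

end

theory Submission
  imports Defs
begin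

text \<open>The Hessian of the entropy becomes diagonal under congruence with the Jacobian of the primitive
  variables \<open>V = (\<rho>, u, \<theta>, \<eta>)\<close>, and in these variables all products with its inverse are short. Let \<open>J\<close> be the
  Jacobian of \<open>V \<mapsto> W\<close>. The Gibbs relation \<open>de = \<theta> ds - p d(1/\<rho>)\<close> removes all derivatives of \<open>e\<close> and
  \<open>s\<close> from the gradient of the entropy with respect to \<open>W\<close>; what remains are the entropy variables
  \<open>y = ((e + p/\<rho> - u\<^sup>2/2)/\<theta> - s, u/\<theta>, -1/\<theta>, -\<eta>\<^sup>-\<^sup>1\<^sup>/\<^sup>4)\<close>. By the same relation
  \<open>J\<^sup>T D\<^sub>Vy = K\<close> with the diagonal matrix
  \<open>K = diag(p\<^sub>\<rho>/(\<rho>\<theta>), \<rho>/\<theta>, \<rho>e\<^sub>\<theta>/\<theta>\<^sup>2, \<eta>\<^sup>-\<^sup>5\<^sup>/\<^sup>4/4)\<close>. The Hessian is therefore congruent to a positive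
  diagonal matrix: \<open>H = J\<^sup>-\<^sup>T K J\<^sup>-\<^sup>1\<close>, hence \<open>H\<^sup>-\<^sup>1 = J K\<^sup>-\<^sup>1 J\<^sup>T\<close>
  (\<open>entropy_vars_jac_factorization\<close>, \<open>entropy_hessian_right_inverse\<close>). This is the symmetric positive
  definite \<open>A\<^sup>0\<close>.

  Every other coefficient has the form \<open>X H\<^sup>-\<^sup>1\<close> and
  \<open>X H\<^sup>-\<^sup>1 = (X J) K\<^sup>-\<^sup>1 J\<^sup>T\<close>. If \<open>X\<close> is the derivative of the flux or of the source in \<open>W\<close>, then \<open>X J\<close>
  is its derivative in \<open>V\<close>, so that no derivative of the inverse \<open>W \<mapsto> V\<close> remains. The convective part
  contributes \<open>u A\<^sup>0\<close>, which is symmetric, and a remainder in which the coupling of velocity and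
  radiation produces \<open>4 \<eta>\<^sup>5\<^sup>/\<^sup>4/3\<close> on one side of the diagonal and \<open>4 \<eta>\<theta>/3\<close> on the other: these agree
  exactly when \<open>\<eta> = \<theta>\<^sup>4\<close> (\<open>transport_symmetric\<close>). The relaxation matrix is \<open>4\<sigma>\<^sub>a\<theta>\<^sup>5\<close> times
  the block with entries \<open>1, -1, -1, 1\<close>, again because of equilibrium
  (\<open>relaxation_pos_semidef\<close>), and the diffusion matrix keeps a single nonnegative diagonal entry.

  The passage to the variable \<open>Z\<close> is independent of the particular system: the nonlinear operator is
  evaluated at \<open>Wb + \<epsilon> U\<close>, differentiated in \<open>\<epsilon>\<close>, and \<open>U = H\<^sup>-\<^sup>1 Z\<close> is inserted
  (\<open>linearization_around_constant_state\<close>, \<open>linearization_in_transformed_variable\<close>).\<close>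

section \<open>Functions of two variables\<close>

lemma has_derivative_slice:
  fixes f :: "real \<Rightarrow> real \<Rightarrow> 'a::real_normed_vector"
  assumes "((\<lambda>(a, b). f a b) has_derivative F) (at (a, b))"
  shows has_derivative_slice_fst: "((\<lambda>r. f r b) has_vector_derivative F (1, 0)) (at a)"
    and has_derivative_slice_snd: "((\<lambda>r. f a r) has_vector_derivative F (0, 1)) (at b)"
proof -
  have lin: "linear F"
    using assms has_derivative_linear by blast
  have "F (h, 0) = h *\<^sub>R F (1, 0)" "F (0, h) = h *\<^sub>R F (0, 1)" for h
    using linear_scale[OF lin, of h "(1, 0)"] linear_scale[OF lin, of h "(0, 1)"] by simp_all
  then have *: "(\<lambda>h. F (h, 0)) = (\<lambda>h. h *\<^sub>R F (1, 0))" "(\<lambda>h. F (0, h)) = (\<lambda>h. h *\<^sub>R F (0, 1))"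
    by blast+
  have "((\<lambda>r. (r, b)) has_derivative (\<lambda>h. (h, 0))) (at a)"
    by (auto intro!: derivative_eq_intros)
  from has_derivative_compose[OF this assms]
  show "((\<lambda>r. f r b) has_vector_derivative F (1, 0)) (at a)"
    by (simp only: has_vector_derivative_def * prod.case)
  have "((\<lambda>r. (a, r)) has_derivative (\<lambda>h. (0, h))) (at b)"
    by (auto intro!: derivative_eq_intros)
  from has_derivative_compose[OF this assms]
  show "((\<lambda>r. f a r) has_vector_derivative F (0, 1)) (at b)"
    by (simp only: has_vector_derivative_def * prod.case)
qed

lemma frechet_derivative_eq_partials:
  assumes "(\<lambda>(a, b). g a b) differentiable (at (a, b))"
  shows "frechet_derivative (\<lambda>(a, b). g a b) (at (a, b)) =
           (\<lambda>h. D_rho g a b * fst h + D_theta g a b * snd h)"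
proof
  fix h :: "real \<times> real"
  let ?F = "frechet_derivative (\<lambda>(a, b). g a b) (at (a, b))"
  have F: "((\<lambda>(a, b). g a b) has_derivative ?F) (at (a, b))"
    using assms frechet_derivative_works by blast
  have "D_rho g a b = ?F (1, 0)" "D_theta g a b = ?F (0, 1)"
    unfolding D_rho_def D_theta_def
    using has_derivative_slice[OF F]
    by (auto intro!: DERIV_imp_deriv simp: has_real_derivative_iff_has_vector_derivative)
  moreover have "?F h = fst h * ?F (1, 0) + snd h * ?F (0, 1)"
    using linear_add[OF has_derivative_linear[OF F], of "fst h *\<^sub>R (1, 0)" "snd h *\<^sub>R (0, 1)"]
      linear_scale[OF has_derivative_linear[OF F], of "fst h" "(1, 0)"]
      linear_scale[OF has_derivative_linear[OF F], of "snd h" "(0, 1)"]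
    by simp
  ultimately show "?F h = D_rho g a b * fst h + D_theta g a b * snd h"
    by simp
qed

lemma C1_has_derivative_partials:
  assumes "Ck_on 1 (\<lambda>(a, b). g a b) S" and "(a, b) \<in> S"
  shows "((\<lambda>(a, b). g a b) has_derivative
           (\<lambda>h. D_rho g a b * fst h + D_theta g a b * snd h)) (at (a, b))"
proof -
  have "(\<lambda>(a, b). g a b) differentiable (at (a, b))"
    using assms by simp
  then show ?thesis
    using frechet_derivative_eq_partials[of g a b] frechet_derivative_works[of "\<lambda>(a, b). g a b" "at (a, b)"] by simp
qed

lemma C1_continuous_partials:
  assumes "Ck_on 1 (\<lambda>(a, b). g a b) S"
  shows "continuous_on S (\<lambda>(a, b). D_rho g a b)" "continuous_on S (\<lambda>(a, b). D_theta g a b)"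
proof -
  have d: "(\<lambda>(a, b). g a b) differentiable (at (a, b))" if "(a, b) \<in> S" for a b
    using assms that by simp
  have c: "continuous_on S (\<lambda>x. frechet_derivative (\<lambda>(a, b). g a b) (at x) b)" if "b \<in> Basis" for b
    using assms that by simp
  show "continuous_on S (\<lambda>(a, b). D_rho g a b)"
    by (rule continuous_on_eq[OF c[of "(1, 0)"]])
       (auto simp: Basis_prod_def frechet_derivative_eq_partials[OF d])
  show "continuous_on S (\<lambda>(a, b). D_theta g a b)"
    by (rule continuous_on_eq[OF c[of "(0, 1)"]])
       (auto simp: Basis_prod_def frechet_derivative_eq_partials[OF d])
qed

section \<open>Linearization of a balance law at a constant state\<close>

text \<open>The derivatives of a field that the linearized equation contains. The first space derivative is
  needed on a whole neighbourhood of \<open>x\<close>, because it is differentiated once more.\<close>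

lemma C2_field_slices:
  fixes W :: "real \<Rightarrow> real \<Rightarrow> 'a::real_normed_vector"
  assumes C2: "Ck_on 2 (\<lambda>(t, x). W t x) \<Omega>" and \<Omega>: "open \<Omega>" "(t, x) \<in> \<Omega>"
  obtains w\<^sub>t X w\<^sub>x w\<^sub>x\<^sub>x where
    "((\<lambda>\<tau>. W \<tau> x) has_vector_derivative w\<^sub>t) (at t)"
    "open X" "x \<in> X" "\<And>\<xi>. \<xi> \<in> X \<Longrightarrow> ((\<lambda>\<xi>. W t \<xi>) has_vector_derivative w\<^sub>x \<xi>) (at \<xi>)"
    "(w\<^sub>x has_vector_derivative w\<^sub>x\<^sub>x) (at x)"
proof -
  let ?f = "\<lambda>(t, x). W t x"
  let ?F = "\<lambda>q. frechet_derivative ?f (at q)"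
  define X where "X = {\<xi>. (t, \<xi>) \<in> \<Omega>}"
  have "X = Pair t -` \<Omega>"
    by (auto simp: X_def)
  then have X: "open X" "x \<in> X"
    using \<Omega> by (auto simp: X_def intro!: open_vimage continuous_intros)
  have F: "(?f has_derivative ?F q) (at q)" if "q \<in> \<Omega>" for q
    using C2 that frechet_derivative_works by (fastforce simp: numeral_2_eq_2)
  have "(0, 1) \<in> (Basis :: (real \<times> real) set)"
    by (simp add: Basis_prod_def)
  then have "(\<lambda>q. ?F q (0, 1)) differentiable (at (t, x))"
    using C2 \<Omega>(2) by (simp add: numeral_2_eq_2)
  then obtain D where D: "((\<lambda>q. ?F q (0, 1)) has_derivative D) (at (t, x))"
    unfolding differentiable_def by blast
  show thesis
  proof (rule that[OF _ X])
    show "((\<lambda>\<tau>. W \<tau> x) has_vector_derivative ?F (t, x) (1, 0)) (at t)"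
      using has_derivative_slice_fst[OF F] \<Omega>(2) by simp
    show "((\<lambda>\<xi>. W t \<xi>) has_vector_derivative ?F (t, \<xi>) (0, 1)) (at \<xi>)" if "\<xi> \<in> X" for \<xi>
      using has_derivative_slice_snd[OF F] that by (simp add: X_def)
    show "((\<lambda>\<xi>. ?F (t, \<xi>) (0, 1)) has_vector_derivative D (0, 1)) (at x)"
      using D by (intro has_derivative_slice_snd[where f = "\<lambda>t \<xi>. ?F (t, \<xi>) (0, 1)"])
        (simp add: case_prod_unfold)
  qed
qed

text \<open>The product rule at \<open>0\<close> for a factor that is merely continuous. It suffices for the terms
  \<open>Df(W) W\<^sub>x\<close> and \<open>C(W) W\<^sub>x\<close>: along \<open>Wb + \<epsilon> U\<close> their factor \<open>W\<^sub>x\<close> is already proportional to \<open>\<epsilon>\<close>.\<close>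

lemma has_vector_derivative_scaleR_at_0:
  fixes g :: "real \<Rightarrow> 'a::real_normed_vector"
  assumes "isCont g 0"
  shows "((\<lambda>\<epsilon>. \<epsilon> *\<^sub>R g \<epsilon>) has_vector_derivative g 0) (at 0)"
proof -
  have "((\<lambda>h. norm (g h - g 0)) \<longlongrightarrow> 0) (at 0)"
    using assms unfolding isCont_def by (metis LIM_zero tendsto_norm_zero)
  then have "((\<lambda>h. norm (h *\<^sub>R g h - h *\<^sub>R g 0) / norm h) \<longlongrightarrow> 0) (at 0)"
    by (rule Lim_transform_eventually)
       (auto simp: eventually_at_filter simp flip: scaleR_diff_right)
  then show ?thesis
    by (auto simp: has_vector_derivative_def has_derivative_at intro!: bounded_linear_intros)
qed

lemma isCont_matrix_vector_mult:
  fixes A :: "real \<Rightarrow> real ^ 'n ^ 'm"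
  assumes "isCont A a"
  shows "isCont (\<lambda>x. A x *v v) a"
  using assms unfolding isCont_def matrix_vector_mult_def
  by (auto intro!: tendsto_vec_lambda tendsto_sum tendsto_intros)

text \<open>For a constant state all terms that contain derivatives of \<open>W\<close> are \<open>\<epsilon>\<close> times a continuous
  function of \<open>\<epsilon>\<close>, so that only \<open>Q\<close> contributes a derivative of a coefficient.\<close>

theorem linearization_around_constant_state:
  fixes f Q :: "real ^ 'n \<Rightarrow> real ^ 'n" and C Df :: "real ^ 'n \<Rightarrow> real ^ 'n ^ 'n"
  assumes N: "open N" "Wb \<in> N"
    and f: "\<And>w. w \<in> N \<Longrightarrow> (f has_derivative (*v) (Df w)) (at w)"
    and Df: "isCont Df Wb" and C: "isCont C Wb"
    and Q: "(Q has_derivative (*v) DQ) (at Wb)"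
    and ut: "((\<lambda>\<tau>. U \<tau> x) has_vector_derivative u\<^sub>t) (at t)"
    and X: "open X" "x \<in> X"
    and ux: "\<And>\<xi>. \<xi> \<in> X \<Longrightarrow> ((\<lambda>\<xi>. U t \<xi>) has_vector_derivative u\<^sub>x \<xi>) (at \<xi>)"
    and uxx: "(u\<^sub>x has_vector_derivative u\<^sub>x\<^sub>x) (at x)"
  shows "linearization_value (system_residual f G C Q) Wb U t x
           (u\<^sub>t + (Df Wb - C Wb) *v u\<^sub>x x - DQ *v U t x - G *v u\<^sub>x\<^sub>x)"
proof -
  define w where "w \<epsilon> = Wb + \<epsilon> *\<^sub>R U t x" for \<epsilon> :: real
  have w0 [simp]: "w 0 = Wb"
    by (simp add: w_def)
  have w_cont: "isCont w \<epsilon>" for \<epsilon>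
    unfolding w_def by (intro continuous_intros)
  have w_deriv: "(w has_vector_derivative U t x) (at 0)"
    unfolding w_def has_vector_derivative_def by (auto intro!: derivative_eq_intros)
  \<comment> \<open>For these \<open>\<epsilon>\<close> the perturbed state at \<open>(t, x)\<close> stays where the flux is differentiable.\<close>
  define E where "E = w -` N"
  have "continuous_on UNIV w"
    unfolding w_def by (intro continuous_intros)
  then have E: "open E" "0 \<in> E"
    unfolding E_def using N by (simp_all add: open_vimage)
  define R where "R \<epsilon> = \<epsilon> *\<^sub>R u\<^sub>t + \<epsilon> *\<^sub>R (Df (w \<epsilon>) *v u\<^sub>x x)
      - (\<epsilon> *\<^sub>R (G *v u\<^sub>x\<^sub>x) + \<epsilon> *\<^sub>R (C (w \<epsilon>) *v u\<^sub>x x) + Q (w \<epsilon>))" for \<epsilon>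
  have "(R has_vector_derivative
      (u\<^sub>t + Df Wb *v u\<^sub>x x - (G *v u\<^sub>x\<^sub>x + C Wb *v u\<^sub>x x + DQ *v U t x))) (at 0)"
  proof -
    have A: "((\<lambda>\<epsilon>. \<epsilon> *\<^sub>R (A (w \<epsilon>) *v u\<^sub>x x)) has_vector_derivative A Wb *v u\<^sub>x x) (at 0)"
      if "isCont A Wb" for A :: "real ^ 'n \<Rightarrow> real ^ 'n ^ 'n"
    proof -
      have "isCont (\<lambda>\<epsilon>. A (w \<epsilon>)) 0"
        by (rule isCont_o2[OF w_cont]) (simp add: that)
      from has_vector_derivative_scaleR_at_0[OF isCont_matrix_vector_mult[OF this]]
      show ?thesis by simp
    qed
    have "(Q has_derivative (*v) DQ) (at (w 0))"
      using Q by simp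
    from has_derivative_compose[OF w_deriv[unfolded has_vector_derivative_def] this]
    have Qw: "((\<lambda>\<epsilon>. Q (w \<epsilon>)) has_vector_derivative DQ *v U t x) (at 0)"
      by (simp add: has_vector_derivative_def matrix_vector_mult_scaleR)
    show ?thesis
      unfolding R_def
      by (intro has_vector_derivative_add has_vector_derivative_diff A[OF Df] A[OF C] Qw
          has_vector_derivative_scaleR_at_0[where g = "\<lambda>_. _"] continuous_const)
  qed
  moreover have "R \<epsilon> = system_residual f G C Q (\<lambda>t x. Wb + \<epsilon> *\<^sub>R U t x) t x" if "\<epsilon> \<in> E" for \<epsilon>
  proof -
    let ?W = "\<lambda>t x. Wb + \<epsilon> *\<^sub>R U t x"
    have scaled: "((\<lambda>r. Wb + \<epsilon> *\<^sub>R g r) has_vector_derivative \<epsilon> *\<^sub>R g') (at r)"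
      if "(g has_vector_derivative g') (at r)" for g :: "real \<Rightarrow> real ^ 'n" and g' r
      using that unfolding has_vector_derivative_def
      by (auto intro!: derivative_eq_intros)
    have Wt: "Dt ?W t x = \<epsilon> *\<^sub>R u\<^sub>t"
      unfolding Dt_def by (intro vector_derivative_at scaled ut)
    have Wx: "Dx ?W t \<xi> = \<epsilon> *\<^sub>R u\<^sub>x \<xi>" if "\<xi> \<in> X" for \<xi>
      unfolding Dx_def by (intro vector_derivative_at scaled ux that)
    have "(f has_derivative (*v) (Df (?W t x))) (at (?W t x))"
      using f \<open>\<epsilon> \<in> E\<close> by (simp add: E_def w_def)
    from has_derivative_compose[OF scaled[OF ux[OF X(2)], unfolded has_vector_derivative_def] this]
    have fx: "Dx (\<lambda>t x. f (?W t x)) t x = \<epsilon> *\<^sub>R (Df (w \<epsilon>) *v u\<^sub>x x)"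
      unfolding Dx_def w_def
      by (intro vector_derivative_at)
         (simp add: has_vector_derivative_def matrix_vector_mult_scaleR)
    have "((\<lambda>\<xi>. G *v (\<epsilon> *\<^sub>R u\<^sub>x \<xi>)) has_vector_derivative G *v (\<epsilon> *\<^sub>R u\<^sub>x\<^sub>x)) (at x)"
      by (intro bounded_linear.has_vector_derivative[OF matrix_vector_mul_bounded_linear]
          bounded_linear.has_vector_derivative[OF bounded_linear_scaleR_right] uxx)
    then have "((\<lambda>\<xi>. G *v Dx ?W t \<xi>) has_vector_derivative G *v (\<epsilon> *\<^sub>R u\<^sub>x\<^sub>x)) (at x)"
      by (rule has_vector_derivative_transform_within_open[OF _ X]) (simp add: Wx)
    then have Gx: "Dx (\<lambda>t x. G *v Dx ?W t x) t x = \<epsilon> *\<^sub>R (G *v u\<^sub>x\<^sub>x)"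
      unfolding Dx_def[of "\<lambda>t x. G *v Dx ?W t x"]
      by (simp add: vector_derivative_at matrix_vector_mult_scaleR)
    show ?thesis
      by (simp add: system_residual_def R_def Wt Wx[OF X(2)] fx Gx w_def matrix_vector_mult_scaleR)
  qed
  ultimately have "((\<lambda>\<epsilon>. system_residual f G C Q (\<lambda>t x. Wb + \<epsilon> *\<^sub>R U t x) t x) has_vector_derivative
      (u\<^sub>t + Df Wb *v u\<^sub>x x - (G *v u\<^sub>x\<^sub>x + C Wb *v u\<^sub>x x + DQ *v U t x))) (at 0)"
    by (rule has_vector_derivative_transform_within_open[OF _ E])
  then show ?thesis
    unfolding linearization_value_def
    by (simp add: matrix_vector_mult_diff_rdistrib algebra_simps)
qed

text \<open>Since \<open>U = S Z\<close> and \<open>S\<close> is constant, each coefficient of the linearization is multiplied by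
  \<open>S\<close> from the right.\<close>

lemma linearization_in_transformed_variable:
  fixes W :: "real \<Rightarrow> real \<Rightarrow> real ^ 'n" and H S G DQ :: "real ^ 'n ^ 'n"
  assumes N: "open N" "Wb \<in> N"
    and f: "\<And>w. w \<in> N \<Longrightarrow> (f has_derivative (*v) (Df w)) (at w)"
    and Df: "isCont Df Wb" and C: "isCont C Wb"
    and Q: "(Q has_derivative (*v) DQ) (at Wb)"
    and H: "S ** H = mat 1"
    and W: "Ck_on 2 (\<lambda>(t, x). W t x) \<Omega>" "open \<Omega>" "(t, x) \<in> \<Omega>"
  defines "Z \<equiv> \<lambda>t x. H *v (W t x - Wb)"
  shows "linearization_value (system_residual f G C Q) Wb (\<lambda>t x. W t x - Wb) t x
           (S *v Dt Z t x + ((Df Wb - C Wb) ** S) *v Dx Z t x + (- DQ ** S) *v Z t x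
             - (G ** S) *v Dx (Dx Z) t x)"
proof -
  obtain w\<^sub>t X w\<^sub>x w\<^sub>x\<^sub>x where
    w: "((\<lambda>\<tau>. W \<tau> x) has_vector_derivative w\<^sub>t) (at t)" "open X" "x \<in> X"
      "\<And>\<xi>. \<xi> \<in> X \<Longrightarrow> ((\<lambda>\<xi>. W t \<xi>) has_vector_derivative w\<^sub>x \<xi>) (at \<xi>)"
      "(w\<^sub>x has_vector_derivative w\<^sub>x\<^sub>x) (at x)"
    by (rule C2_field_slices[OF W]) (rule that)
  have shift: "((\<lambda>r. g r - Wb) has_vector_derivative g') (at r)"
    if "(g has_vector_derivative g') (at r)" for g g' r
    using has_vector_derivative_diff[OF that has_vector_derivative_const[of Wb]] by simp
  have mult: "((\<lambda>r. H *v g r) has_vector_derivative H *v g') (at r)"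
    if "(g has_vector_derivative g') (at r)" for g g' r
    using that by (rule bounded_linear.has_vector_derivative[OF matrix_vector_mul_bounded_linear])
  have Zt: "Dt Z t x = H *v w\<^sub>t"
    unfolding Dt_def Z_def by (intro vector_derivative_at mult shift w)
  have Zx: "Dx Z t \<xi> = H *v w\<^sub>x \<xi>" if "\<xi> \<in> X" for \<xi>
    unfolding Dx_def Z_def by (intro vector_derivative_at mult shift w that)
  have "((\<lambda>\<xi>. Dx Z t \<xi>) has_vector_derivative H *v w\<^sub>x\<^sub>x) (at x)"
    using mult[OF w(5)] by (rule has_vector_derivative_transform_within_open[OF _ w(2,3)]) (simp add: Zx)
  then have Zxx: "Dx (Dx Z) t x = H *v w\<^sub>x\<^sub>x"
    unfolding Dx_def[of "Dx Z"] by (rule vector_derivative_at)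
  have SH: "S *v (H *v v) = v" for v
    by (simp add: matrix_vector_mul_assoc H)
  have "linearization_value (system_residual f G C Q) Wb (\<lambda>t x. W t x - Wb) t x
          (w\<^sub>t + (Df Wb - C Wb) *v w\<^sub>x x - DQ *v (W t x - Wb) - G *v w\<^sub>x\<^sub>x)"
    using linearization_around_constant_state[OF N f Df C Q, where U = "\<lambda>t x. W t x - Wb",
        OF _ shift[OF w(1)] w(2,3) shift[OF w(4)] w(5)] by simp
  moreover have "(A ** S) *v (H *v v) = A *v v" for A :: "real ^ 'n ^ 'n" and v
    by (simp add: SH flip: matrix_vector_mul_assoc)
  moreover have "- DQ *v v = - (DQ *v v)" for v
    by (simp add: vec_eq_iff matrix_vector_mult_def sum_negf)
  ultimately show ?thesis
    by (simp add: Zt Zx[OF w(3)] Zxx SH) (simp add: Z_def)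
qed

lemma linearization_value_unique:
  "linearization_value F Wb U t x R \<Longrightarrow> linearization_value F Wb U t x R' \<Longrightarrow> R = R'"
  unfolding linearization_value_def by (rule vector_derivative_unique_at)

section \<open>Vectors and matrices\<close>

lemmas mat_4_simps = vec_eq_iff forall_4 sum_4 matrix_matrix_mult_def matrix_vector_mult_def
  transpose_def mat_def

lemma has_derivative_vector_4:
  fixes f1 f2 f3 f4 :: "'a::real_normed_vector \<Rightarrow> real"
  assumes "(f1 has_derivative f1') F" "(f2 has_derivative f2') F"
    "(f3 has_derivative f3') F" "(f4 has_derivative f4') F"
  shows "((\<lambda>x. vector [f1 x, f2 x, f3 x, f4 x] :: real ^ 4) has_derivative
           (\<lambda>h. vector [f1' h, f2' h, f3' h, f4' h])) F"
proof -
  have *: "(vector [a, b, c, d] :: real ^ 4) = a *\<^sub>R axis 1 1 + b *\<^sub>R axis 2 1 + c *\<^sub>R axis 3 1 + d *\<^sub>R axis 4 1"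
    for a b c d :: real
    by (simp add: vec_eq_iff forall_4 axis_def)
  show ?thesis
    unfolding * by (intro has_derivative_add has_derivative_scaleR_left assms)
qed

lemma isCont_vector_4:
  fixes f1 f2 f3 f4 :: "'a::t2_space \<Rightarrow> 'b::{zero,topological_space}"
  assumes "isCont f1 a" "isCont f2 a" "isCont f3 a" "isCont f4 a"
  shows "isCont (\<lambda>x. vector [f1 x, f2 x, f3 x, f4 x] :: 'b ^ 4) a"
proof -
  have "\<forall>i. ((\<lambda>x. vector [f1 x, f2 x, f3 x, f4 x] $ i) \<longlongrightarrow>
          (vector [f1 a, f2 a, f3 a, f4 a] :: 'b ^ 4) $ i) (at a)"
    unfolding forall_4 using assms by (simp add: isCont_def)
  then show ?thesis
    unfolding isCont_def by (intro vec_tendstoI) blast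
qed

lemma isCont_matrix_mult:
  fixes A :: "'a::t2_space \<Rightarrow> real ^ 'n ^ 'm" and B :: "'a \<Rightarrow> real ^ 'k ^ 'n"
  assumes "isCont A a" "isCont B a"
  shows "isCont (\<lambda>x. A x ** B x) a"
  using assms unfolding isCont_def matrix_matrix_mult_def
  by (intro tendsto_vec_lambda tendsto_sum tendsto_mult tendsto_vec_nth)

lemma jacobian_eq:
  fixes f :: "real ^ 'n \<Rightarrow> real ^ 'm"
  assumes "(f has_derivative (*v) A) (at x)"
  shows "jacobian f (at x) = A"
  unfolding jacobian_def frechet_derivative_at[OF assms, symmetric] by simp

lemma gradient_eq:
  assumes "(f has_derivative (\<lambda>h. v \<bullet> h)) (at x)"
  shows "gradient f x = v"
  unfolding gradient_def frechet_derivative_at[OF assms, symmetric]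
  by (simp add: inner_axis)

lemma matrix_inv_eq:
  fixes A :: "real ^ 'n ^ 'n"
  assumes "A ** B = mat 1"
  shows "invertible A" "matrix_inv A = B"
proof -
  show inv: "invertible A"
    using assms by (auto simp: invertible_right_inverse)
  have "B ** A = mat 1"
    using assms matrix_left_right_inverse by blast
  then have "matrix_inv A = B ** (A ** matrix_inv A)"
    by (simp add: matrix_mul_assoc)
  also have "\<dots> = B"
    using someI_ex[OF inv[unfolded invertible_def]] by (simp add: matrix_inv_def)
  finally show "matrix_inv A = B" .
qed

text \<open>\<open>x \<bullet> J K J\<^sup>T x\<close> is the form of \<open>K\<close> at \<open>J\<^sup>T x\<close>, and \<open>J\<^sup>T\<close> has trivial kernel.\<close>

lemma sym_pos_def_congruence:
  fixes J K :: "real ^ 'n ^ 'n"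
  assumes "sym_pos_def K" "invertible J"
  shows "sym_pos_def (J ** K ** transpose J)"
proof -
  have "x \<bullet> (J ** K ** transpose J *v x) = (transpose J *v x) \<bullet> (K *v (transpose J *v x))" for x
    by (metis dot_lmul_matrix matrix_vector_mul_assoc transpose_matrix_vector)
  moreover have "transpose J *v x \<noteq> 0" if "x \<noteq> 0" for x
    using that assms(2)
    by (metis invertible_left_inverse matrix_left_invertible_ker transpose_invertible)
  ultimately show ?thesis
    using assms(1) by (auto simp: sym_pos_def_def matrix_transpose_mul matrix_mul_assoc)
qed

lemma matrix_diff_rdistrib:
  fixes A B :: "real ^ 'n ^ 'm"
  shows "(A - B) ** D = A ** D - B ** D"
  by (simp add: vec_eq_iff matrix_matrix_mult_def left_diff_distrib sum_subtractf)

lemma matrix_minus_left: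
  fixes A :: "real ^ 'n ^ 'm"
  shows "- A ** D = - (A ** D)"
  by (simp add: vec_eq_iff matrix_matrix_mult_def sum_negf)

lemma matrix_scaleR_left:
  fixes A :: "real ^ 'n ^ 'm"
  shows "(r *\<^sub>R A) ** D = r *\<^sub>R (A ** D)"
  by (simp add: vec_eq_iff matrix_matrix_mult_def sum_distrib_left mult.assoc)

section \<open>The conservative and the primitive variables\<close>

lemma C1_thermo_has_derivative:
  assumes "Ck_on 1 (\<lambda>(\<rho>, \<theta>). g \<rho> \<theta>) thermo_domain" and "V \<in> prim_domain"
  shows "((\<lambda>V. g (V $ 1) (V $ 3)) has_derivative
           (\<lambda>h. D_rho g (V $ 1) (V $ 3) * h $ 1 + D_theta g (V $ 1) (V $ 3) * h $ 3)) (at V)"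
proof -
  have "(V $ 1, V $ 3) \<in> thermo_domain"
    using assms(2) by (simp add: prim_domain_def thermo_domain_def)
  note g = C1_has_derivative_partials[OF assms(1) this]
  have "((\<lambda>V. (V $ 1, V $ 3)) has_derivative (\<lambda>h. (h $ 1, h $ 3))) (at V)"
    by (intro has_derivative_Pair bounded_linear_imp_has_derivative bounded_linear_vec_nth)
  from has_derivative_compose[OF this g] show ?thesis
    by simp
qed

lemma C1_thermo_isCont:
  assumes "Ck_on 1 (\<lambda>(\<rho>, \<theta>). g \<rho> \<theta>) thermo_domain" and "V \<in> prim_domain"
  shows "isCont (\<lambda>V. g (V $ 1) (V $ 3)) V"
    and "isCont (\<lambda>V. D_rho g (V $ 1) (V $ 3)) V"
    and "isCont (\<lambda>V. D_theta g (V $ 1) (V $ 3)) V"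
proof -
  have "(V $ 1, V $ 3) \<in> thermo_domain"
    using assms(2) by (simp add: prim_domain_def thermo_domain_def)
  moreover have "open thermo_domain"
    by (simp add: thermo_domain_def open_Times)
  moreover have "isCont (\<lambda>V. (V $ 1, V $ 3)) V"
    by (intro continuous_intros)
  ultimately have *: "isCont (\<lambda>V. h (V $ 1) (V $ 3)) V"
    if "continuous_on thermo_domain (\<lambda>(\<rho>, \<theta>). h \<rho> \<theta>)" for h :: "real \<Rightarrow> real \<Rightarrow> real"
    using isCont_o2[of V "\<lambda>V. (V $ 1, V $ 3)" "\<lambda>(\<rho>, \<theta>). h \<rho> \<theta>"] that
    by (simp add: continuous_on_eq_continuous_at)
  show "isCont (\<lambda>V. g (V $ 1) (V $ 3)) V"
    using C1_thermo_has_derivative[OF assms] by (rule has_derivative_continuous)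
  show "isCont (\<lambda>V. D_rho g (V $ 1) (V $ 3)) V" "isCont (\<lambda>V. D_theta g (V $ 1) (V $ 3)) V"
    by (intro * C1_continuous_partials[OF assms(1)])+
qed

lemma open_prim_domain: "open prim_domain"
proof -
  have "prim_domain = {V. V $ 1 > 0} \<inter> {V. V $ 3 > 0} \<inter> {V. V $ 4 > 0}"
    by (auto simp: prim_domain_def)
  also have "open \<dots>"
    by (intro open_Int open_halfspace_component_gt_cart)
  finally show ?thesis .
qed

text \<open>The Jacobian \<open>J\<close> of \<open>V \<mapsto> W\<close> and its inverse, the Jacobian of \<open>W \<mapsto> V\<close> written in terms of \<open>V\<close>.
  The matrix \<open>J\<close> is lower triangular with diagonal \<open>1, \<rho>, \<rho>e\<^sub>\<theta>, 1\<close>.\<close>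

definition cons_jac :: "(real \<Rightarrow> real \<Rightarrow> real) \<Rightarrow> real ^ 4 \<Rightarrow> real ^ 4 ^ 4" where
  "cons_jac e V =
     (let \<rho> = V $ 1; u = V $ 2; \<theta> = V $ 3
      in vector [vector [1, 0, 0, 0],
                 vector [u, \<rho>, 0, 0],
                 vector [e \<rho> \<theta> + u\<^sup>2 / 2 + \<rho> * D_rho e \<rho> \<theta>, \<rho> * u, \<rho> * D_theta e \<rho> \<theta>, 0],
                 vector [0, 0, 0, 1]])"

definition prim_jac :: "(real \<Rightarrow> real \<Rightarrow> real) \<Rightarrow> real ^ 4 \<Rightarrow> real ^ 4 ^ 4" where
  "prim_jac e V =
     (let \<rho> = V $ 1; u = V $ 2; \<theta> = V $ 3; d = \<rho> * D_theta e \<rho> \<theta>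
      in vector [vector [1, 0, 0, 0],
                 vector [- u / \<rho>, 1 / \<rho>, 0, 0],
                 vector [(u\<^sup>2 / 2 - e \<rho> \<theta> - \<rho> * D_rho e \<rho> \<theta>) / d, - u / d, 1 / d, 0],
                 vector [0, 0, 0, 1]])"

text \<open>The fluid is described by \<open>p, e, s\<close>; the Gibbs relation \<open>de = \<theta> ds - p d(1/\<rho>)\<close> is split into its
  components, with the Maxwell relation \<open>s\<^sub>\<rho> = -p\<^sub>\<theta>/\<rho>\<^sup>2\<close> inserted into \<open>e\<^sub>\<rho> = \<theta>s\<^sub>\<rho> + p/\<rho>\<^sup>2\<close>.\<close>

locale thermodynamics =
  fixes p e s :: "real \<Rightarrow> real \<Rightarrow> real"
  assumes p_C1: "Ck_on 1 (\<lambda>(\<rho>, \<theta>). p \<rho> \<theta>) thermo_domain"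
    and e_C1: "Ck_on 1 (\<lambda>(\<rho>, \<theta>). e \<rho> \<theta>) thermo_domain"
    and s_C1: "Ck_on 1 (\<lambda>(\<rho>, \<theta>). s \<rho> \<theta>) thermo_domain"
    and p_rho_pos: "\<And>\<rho> \<theta>. (\<rho>, \<theta>) \<in> thermo_domain \<Longrightarrow> D_rho p \<rho> \<theta> > 0"
    and e_theta_pos: "\<And>\<rho> \<theta>. (\<rho>, \<theta>) \<in> thermo_domain \<Longrightarrow> D_theta e \<rho> \<theta> > 0"
    and e_rho: "\<And>\<rho> \<theta>. (\<rho>, \<theta>) \<in> thermo_domain \<Longrightarrow>
                  D_rho e \<rho> \<theta> = (p \<rho> \<theta> - \<theta> * D_theta p \<rho> \<theta>) / \<rho>\<^sup>2"
    and s_rho: "\<And>\<rho> \<theta>. (\<rho>, \<theta>) \<in> thermo_domain \<Longrightarrow> D_rho s \<rho> \<theta> = - D_theta p \<rho> \<theta> / \<rho>\<^sup>2"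
    and s_theta: "\<And>\<rho> \<theta>. (\<rho>, \<theta>) \<in> thermo_domain \<Longrightarrow> D_theta s \<rho> \<theta> = D_theta e \<rho> \<theta> / \<theta>"
begin

lemma prim_domain_relations:
  assumes "V \<in> prim_domain"
  shows "V $ 1 > 0" "V $ 3 > 0" "V $ 4 > 0"
    and "D_rho p (V $ 1) (V $ 3) > 0" "D_theta e (V $ 1) (V $ 3) > 0"
    and "D_rho e (V $ 1) (V $ 3) = (p (V $ 1) (V $ 3) - V $ 3 * D_theta p (V $ 1) (V $ 3)) / (V $ 1)\<^sup>2"
    and "D_rho s (V $ 1) (V $ 3) = - D_theta p (V $ 1) (V $ 3) / (V $ 1)\<^sup>2"
    and "D_theta s (V $ 1) (V $ 3) = D_theta e (V $ 1) (V $ 3) / V $ 3"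
proof -
  show *: "V $ 1 > 0" "V $ 3 > 0" "V $ 4 > 0"
    using assms by (simp_all add: prim_domain_def)
  then have "(V $ 1, V $ 3) \<in> thermo_domain"
    by (simp add: thermo_domain_def)
  note p_rho_pos[OF this] e_theta_pos[OF this] e_rho[OF this] s_rho[OF this] s_theta[OF this]
  then show "D_rho p (V $ 1) (V $ 3) > 0" "D_theta e (V $ 1) (V $ 3) > 0"
    "D_rho e (V $ 1) (V $ 3) = (p (V $ 1) (V $ 3) - V $ 3 * D_theta p (V $ 1) (V $ 3)) / (V $ 1)\<^sup>2"
    "D_rho s (V $ 1) (V $ 3) = - D_theta p (V $ 1) (V $ 3) / (V $ 1)\<^sup>2"
    "D_theta s (V $ 1) (V $ 3) = D_theta e (V $ 1) (V $ 3) / V $ 3"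
    by blast+
qed

lemmas thermo_derivs = C1_thermo_has_derivative[OF p_C1] C1_thermo_has_derivative[OF e_C1]
  C1_thermo_has_derivative[OF s_C1] bounded_linear.has_derivative[OF bounded_linear_vec_nth]

lemma cons_of_prim_has_derivative:
  assumes "V \<in> prim_domain"
  shows "(cons_of_prim e has_derivative (*v) (cons_jac e V)) (at V)"
proof -
  \<comment> \<open>The right-hand side is the shape in which the product rule delivers the derivative.\<close>
  have "(\<lambda>h. cons_jac e V *v h) = (\<lambda>h. vector [h $ 1, V $ 1 * h $ 2 + h $ 1 * V $ 2,
      V $ 1 * (D_rho e (V $ 1) (V $ 3) * h $ 1 + D_theta e (V $ 1) (V $ 3) * h $ 3 + V $ 2 * h $ 2)
        + h $ 1 * (e (V $ 1) (V $ 3) + (V $ 2)\<^sup>2 / 2), h $ 4])"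
    by (simp add: fun_eq_iff mat_4_simps cons_jac_def Let_def algebra_simps)
  then show ?thesis
    unfolding cons_of_prim_def[abs_def] Let_def
    by (auto intro!: has_derivative_vector_4 derivative_eq_intros thermo_derivs assms simp: field_simps)
qed

text \<open>The temperature can be recovered from the energy because \<open>e\<^sub>\<theta> > 0\<close>.\<close>

lemma energy_strict_mono:
  assumes "\<rho> > 0" "0 < a" "a < b"
  shows "e \<rho> a < e \<rho> b"
proof (rule DERIV_pos_imp_increasing[OF assms(3)])
  fix \<theta> assume "a \<le> \<theta>" "\<theta> \<le> b"
  then have *: "(\<rho>, \<theta>) \<in> thermo_domain"
    using assms by (simp add: thermo_domain_def)
  from has_derivative_slice_snd[OF C1_has_derivative_partials[OF e_C1 *]]
  have "((\<lambda>\<theta>. e \<rho> \<theta>) has_real_derivative D_theta e \<rho> \<theta>) (at \<theta>)"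
    by (simp add: has_real_derivative_iff_has_vector_derivative)
  then show "\<exists>y. ((\<lambda>\<theta>. e \<rho> \<theta>) has_real_derivative y) (at \<theta>) \<and> 0 < y"
    using e_theta_pos[OF *] by blast
qed

lemma inj_on_cons_of_prim: "inj_on (cons_of_prim e) prim_domain"
proof (rule inj_onI)
  fix V V' assume V: "V \<in> prim_domain" "V' \<in> prim_domain" "cons_of_prim e V = cons_of_prim e V'"
  have pos: "V $ 1 > 0" "V $ 3 > 0" "V' $ 3 > 0"
    using V by (auto simp: prim_domain_def)
  have *: "V $ 1 = V' $ 1" "V $ 2 = V' $ 2" "V $ 4 = V' $ 4" "e (V $ 1) (V $ 3) = e (V $ 1) (V' $ 3)"
    using V(3) pos(1) by (auto simp: cons_of_prim_def Let_def vec_eq_iff forall_4)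
  moreover have "V $ 3 = V' $ 3"
    using energy_strict_mono[OF pos(1), of "V $ 3" "V' $ 3"] energy_strict_mono[OF pos(1), of "V' $ 3" "V $ 3"]
      pos * by (metis linorder_neqE less_irrefl)
  ultimately show "V = V'"
    by (simp add: vec_eq_iff forall_4)
qed

lemma prim_of_cons_of_prim:
  "V \<in> prim_domain \<Longrightarrow> prim_of_cons e (cons_of_prim e V) = V"
  by (simp add: prim_of_cons_def inj_on_cons_of_prim)

lemma prim_of_cons_in_prim_domain:
  "W \<in> cons_domain e \<Longrightarrow> prim_of_cons e W \<in> prim_domain"
  by (simp add: prim_of_cons_def cons_domain_def inv_into_into)

lemma cons_of_prim_of_cons:
  "W \<in> cons_domain e \<Longrightarrow> cons_of_prim e (prim_of_cons e W) = W"
  by (simp add: prim_of_cons_def cons_domain_def f_inv_into_f)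

lemma cons_components:
  assumes "W \<in> cons_domain e"
  defines "V \<equiv> prim_of_cons e W"
  shows "W $ 1 = V $ 1" "W $ 3 = V $ 1 * (e (V $ 1) (V $ 3) + (V $ 2)\<^sup>2 / 2)" "W $ 4 = V $ 4"
  using arg_cong[OF cons_of_prim_of_cons[OF assms(1)], of "\<lambda>W. W $ 1"]
    arg_cong[OF cons_of_prim_of_cons[OF assms(1)], of "\<lambda>W. W $ 3"]
    arg_cong[OF cons_of_prim_of_cons[OF assms(1)], of "\<lambda>W. W $ 4"]
  by (simp_all add: cons_of_prim_def Let_def V_def)

text \<open>Invariance of domain, applied to the continuous injection \<open>V \<mapsto> W\<close>.\<close>

lemma open_cons_domain: "open (cons_domain e)"
  unfolding cons_domain_def
  using cons_of_prim_has_derivative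
  by (intro invariance_of_domain open_prim_domain inj_on_cons_of_prim)
     (meson continuous_at_imp_continuous_on has_derivative_continuous)

lemma cons_jac_prim_jac:
  assumes "V \<in> prim_domain"
  shows "cons_jac e V ** prim_jac e V = mat 1" "prim_jac e V ** cons_jac e V = mat 1"
proof -
  show "cons_jac e V ** prim_jac e V = mat 1"
    using prim_domain_relations(1,5)[OF assms]
    by (simp add: mat_4_simps cons_jac_def prim_jac_def Let_def field_simps power2_eq_square)
  then show "prim_jac e V ** cons_jac e V = mat 1"
    using matrix_left_right_inverse by blast
qed

lemma prim_of_cons_has_derivative:
  assumes "W \<in> cons_domain e"
  shows "(prim_of_cons e has_derivative (*v) (prim_jac e (prim_of_cons e W))) (at W)"
proof -
  let ?V = "prim_of_cons e W"
  note V = prim_of_cons_in_prim_domain[OF assms]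
  have "(*v) (cons_jac e ?V) \<circ> (*v) (prim_jac e ?V) = id"
    using cons_jac_prim_jac[OF V] by (simp add: fun_eq_iff matrix_vector_mul_assoc)
  from has_derivative_inverse_on[where f' = "\<lambda>V. (*v) (cons_jac e V)" and g' = "\<lambda>V. (*v) (prim_jac e V)",
      OF open_prim_domain cons_of_prim_has_derivative prim_of_cons_of_prim this V]
  show ?thesis
    by (simp add: cons_of_prim_of_cons[OF assms])
qed

text \<open>The chain rule in the form used below: a function of \<open>W\<close> is differentiated through its
  expression \<open>F\<close> in the primitive variables.\<close>

lemma has_derivative_via_prim:
  assumes "W \<in> cons_domain e"
    and "(F has_derivative F') (at (prim_of_cons e W))"
    and "\<And>W. W \<in> cons_domain e \<Longrightarrow> f W = F (prim_of_cons e W)"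
  shows "(f has_derivative (\<lambda>k. F' (prim_jac e (prim_of_cons e W) *v k))) (at W)"
  using has_derivative_compose[OF prim_of_cons_has_derivative[OF assms(1)] assms(2)]
  by (rule has_derivative_transform_within_open[OF _ open_cons_domain assms(1)]) (simp add: assms(3))

end

section \<open>Flux, source and nonconservative term\<close>

definition prim_flux :: "(real \<Rightarrow> real \<Rightarrow> real) \<Rightarrow> (real \<Rightarrow> real \<Rightarrow> real) \<Rightarrow> real ^ 4 \<Rightarrow> real ^ 4" where
  "prim_flux e p V =
     (let \<rho> = V $ 1; u = V $ 2; \<theta> = V $ 3; \<eta> = V $ 4
      in vector [\<rho> * u,
                 \<rho> * u\<^sup>2 + p \<rho> \<theta> + \<eta> / 3,
                 \<rho> * (e \<rho> \<theta> + u\<^sup>2 / 2) * u + (p \<rho> \<theta> + \<eta> / 3) * u,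
                 \<eta> * u])"

definition prim_flux_jac ::
    "(real \<Rightarrow> real \<Rightarrow> real) \<Rightarrow> (real \<Rightarrow> real \<Rightarrow> real) \<Rightarrow> real ^ 4 \<Rightarrow> real ^ 4 ^ 4" where
  "prim_flux_jac e p V =
     (let \<rho> = V $ 1; u = V $ 2; \<theta> = V $ 3; \<eta> = V $ 4
      in vector [vector [u, \<rho>, 0, 0],
                 vector [u\<^sup>2 + D_rho p \<rho> \<theta>, 2 * \<rho> * u, D_theta p \<rho> \<theta>, 1 / 3],
                 vector [u * (e \<rho> \<theta> + u\<^sup>2 / 2 + \<rho> * D_rho e \<rho> \<theta> + D_rho p \<rho> \<theta>),
                         \<rho> * (e \<rho> \<theta> + u\<^sup>2 / 2) + p \<rho> \<theta> + \<eta> / 3 + \<rho> * u\<^sup>2,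
                         u * (\<rho> * D_theta e \<rho> \<theta> + D_theta p \<rho> \<theta>),
                         u / 3],
                 vector [0, \<eta>, 0, u]])"

definition prim_source_jac :: "real \<Rightarrow> real ^ 4 \<Rightarrow> real ^ 4 ^ 4" where
  "prim_source_jac \<sigma>a V =
     vector [vector [0, 0, 0, 0],
             vector [0, 0, 0, 0],
             vector [0, 0, - 4 * \<sigma>a * V $ 3 ^ 3, \<sigma>a],
             vector [0, 0, 4 * \<sigma>a * V $ 3 ^ 3, - \<sigma>a]]"

context thermodynamics
begin

lemma flux_has_derivative:
  assumes "W \<in> cons_domain e"
  defines "V \<equiv> prim_of_cons e W"
  shows "(flux e p has_derivative (*v) (prim_flux_jac e p V ** prim_jac e V)) (at W)"
proof -
  have V: "V \<in> prim_domain"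
    using assms prim_of_cons_in_prim_domain by simp
  have "(\<lambda>h. prim_flux_jac e p V *v h) = (\<lambda>h. vector [V $ 1 * h $ 2 + h $ 1 * V $ 2,
      V $ 1 * (2 * V $ 2 * h $ 2) + h $ 1 * (V $ 2)\<^sup>2
        + (D_rho p (V $ 1) (V $ 3) * h $ 1 + D_theta p (V $ 1) (V $ 3) * h $ 3) + h $ 4 / 3,
      V $ 1 * (e (V $ 1) (V $ 3) + (V $ 2)\<^sup>2 / 2) * h $ 2 +
      (V $ 1 * (D_rho e (V $ 1) (V $ 3) * h $ 1 + D_theta e (V $ 1) (V $ 3) * h $ 3 + V $ 2 * h $ 2)
        + h $ 1 * (e (V $ 1) (V $ 3) + (V $ 2)\<^sup>2 / 2)) * V $ 2 + ((p (V $ 1) (V $ 3) + V $ 4 / 3) * h $ 2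
        + (D_rho p (V $ 1) (V $ 3) * h $ 1 + D_theta p (V $ 1) (V $ 3) * h $ 3 + h $ 4 / 3) * V $ 2),
      V $ 4 * h $ 2 + h $ 4 * V $ 2])"
    by (simp add: fun_eq_iff mat_4_simps prim_flux_jac_def Let_def algebra_simps power2_eq_square)
  then have "(prim_flux e p has_derivative (*v) (prim_flux_jac e p V)) (at V)"
    unfolding prim_flux_def[abs_def] Let_def
    by (auto intro!: has_derivative_vector_4 derivative_eq_intros thermo_derivs V simp: field_simps)
  moreover have "flux e p W = prim_flux e p (prim_of_cons e W)" if "W \<in> cons_domain e" for W
    using cons_components[OF that]
    by (simp add: flux_def prim_flux_def velocity_def temperature_def Let_def)
  ultimately have "(flux e p has_derivative (\<lambda>k. prim_flux_jac e p V *v (prim_jac e V *v k))) (at W)"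
    by (rule has_derivative_via_prim[OF assms(1), folded V_def])
  then show ?thesis
    by (simp only: matrix_vector_mul_assoc)
qed

lemma source_has_derivative:
  assumes "W \<in> cons_domain e"
  defines "V \<equiv> prim_of_cons e W"
  shows "(source e \<sigma>a has_derivative (*v) (prim_source_jac \<sigma>a V ** prim_jac e V)) (at W)"
proof -
  have "(\<lambda>h. prim_source_jac \<sigma>a V *v h) = (\<lambda>h. vector [0, 0, \<sigma>a * (h $ 4 - 4 * V $ 3 ^ 3 * h $ 3),
      - \<sigma>a * (h $ 4 - 4 * V $ 3 ^ 3 * h $ 3)])"
    by (simp add: fun_eq_iff mat_4_simps prim_source_jac_def algebra_simps)
  then have "((\<lambda>V. vector [0, 0, \<sigma>a * (V $ 4 - V $ 3 ^ 4), - \<sigma>a * (V $ 4 - V $ 3 ^ 4)])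
      has_derivative (*v) (prim_source_jac \<sigma>a V)) (at V)"
    by (auto intro!: has_derivative_vector_4 derivative_eq_intros thermo_derivs simp: field_simps)
  moreover have "source e \<sigma>a W = (\<lambda>V. vector [0, 0, \<sigma>a * (V $ 4 - V $ 3 ^ 4), - \<sigma>a * (V $ 4 - V $ 3 ^ 4)])
      (prim_of_cons e W)" if "W \<in> cons_domain e" for W
    using cons_components[OF that] by (simp add: source_def temperature_def Let_def)
  ultimately have "(source e \<sigma>a has_derivative (\<lambda>k. prim_source_jac \<sigma>a V *v (prim_jac e V *v k))) (at W)"
    by (rule has_derivative_via_prim[OF assms(1), folded V_def])
  then show ?thesis
    by (simp only: matrix_vector_mul_assoc)
qed

lemma isCont_prim_of_cons: "W \<in> cons_domain e \<Longrightarrow> isCont (prim_of_cons e) W"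
  using prim_of_cons_has_derivative by (rule has_derivative_continuous)

lemma isCont_noncons_matrix:
  assumes "W \<in> cons_domain e"
  shows "isCont (noncons_matrix e) W"
proof -
  note V = prim_of_cons_in_prim_domain[OF assms]
  have "W $ 1 \<noteq> 0"
    using prim_domain_relations(1)[OF V] cons_components[OF assms] by simp
  then show ?thesis
    unfolding noncons_matrix_def[abs_def] velocity_def Let_def
    by (intro isCont_vector_4 continuous_intros isCont_prim_of_cons assms) auto
qed

text \<open>The flux is continuously differentiable because \<open>p\<close> and \<open>e\<close> are and the entries of \<open>J\<^sup>-\<^sup>1\<close> have
  nonvanishing denominators.\<close>

lemma isCont_flux_jacobian:
  assumes "W \<in> cons_domain e"
  shows "isCont (\<lambda>W. prim_flux_jac e p (prim_of_cons e W) ** prim_jac e (prim_of_cons e W)) W"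
proof -
  note V = prim_of_cons_in_prim_domain[OF assms]
  note r = prim_domain_relations[OF V]
  have "isCont (prim_flux_jac e p) (prim_of_cons e W)"
    unfolding prim_flux_jac_def[abs_def] Let_def
    by (intro isCont_vector_4 continuous_intros C1_thermo_isCont[OF e_C1 V] C1_thermo_isCont[OF p_C1 V]) auto
  moreover have "isCont (prim_jac e) (prim_of_cons e W)"
    unfolding prim_jac_def[abs_def] Let_def using r(1,5)
    by (intro isCont_vector_4 continuous_intros C1_thermo_isCont[OF e_C1 V]) auto
  ultimately show ?thesis
    by (intro isCont_matrix_mult isCont_o2[OF isCont_prim_of_cons[OF assms]])
qed

end

section \<open>The entropy and its Hessian\<close>

text \<open>The gradient of the entropy with respect to \<open>W\<close>, as a function of \<open>V\<close>.\<close>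

definition entropy_vars ::
    "(real \<Rightarrow> real \<Rightarrow> real) \<Rightarrow> (real \<Rightarrow> real \<Rightarrow> real) \<Rightarrow> (real \<Rightarrow> real \<Rightarrow> real) \<Rightarrow> real ^ 4 \<Rightarrow> real ^ 4" where
  "entropy_vars e p s V =
     (let \<rho> = V $ 1; u = V $ 2; \<theta> = V $ 3; \<eta> = V $ 4
      in vector [(e \<rho> \<theta> + p \<rho> \<theta> / \<rho> - u\<^sup>2 / 2) / \<theta> - s \<rho> \<theta>,
                 u / \<theta>, - 1 / \<theta>, - (\<eta> powr (- 1 / 4))])"

text \<open>The derivative of the entropy variables in \<open>V\<close>, simplified with the Gibbs relation.\<close>

definition entropy_vars_jac ::
    "(real \<Rightarrow> real \<Rightarrow> real) \<Rightarrow> (real \<Rightarrow> real \<Rightarrow> real) \<Rightarrow> real ^ 4 \<Rightarrow> real ^ 4 ^ 4" where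
  "entropy_vars_jac e p V =
     (let \<rho> = V $ 1; u = V $ 2; \<theta> = V $ 3; \<eta> = V $ 4
      in vector [vector [D_rho p \<rho> \<theta> / (\<rho> * \<theta>), - u / \<theta>,
                         D_theta p \<rho> \<theta> / (\<rho> * \<theta>) - (e \<rho> \<theta> + p \<rho> \<theta> / \<rho> - u\<^sup>2 / 2) / \<theta>\<^sup>2, 0],
                 vector [0, 1 / \<theta>, - u / \<theta>\<^sup>2, 0],
                 vector [0, 0, 1 / \<theta>\<^sup>2, 0],
                 vector [0, 0, 0, \<eta> powr (- 5 / 4) / 4]])"

text \<open>The matrix \<open>K\<^sup>-\<^sup>1\<close>, where \<open>K = J\<^sup>T D\<^sub>Vy\<close> is the Hessian of the entropy transported to the
  primitive variables by congruence.\<close>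

definition entropy_metric_inv ::
    "(real \<Rightarrow> real \<Rightarrow> real) \<Rightarrow> (real \<Rightarrow> real \<Rightarrow> real) \<Rightarrow> real ^ 4 \<Rightarrow> real ^ 4 ^ 4" where
  "entropy_metric_inv e p V =
     (let \<rho> = V $ 1; \<theta> = V $ 3; \<eta> = V $ 4
      in vector [vector [\<rho> * \<theta> / D_rho p \<rho> \<theta>, 0, 0, 0],
                 vector [0, \<theta> / \<rho>, 0, 0],
                 vector [0, 0, \<theta>\<^sup>2 / (\<rho> * D_theta e \<rho> \<theta>), 0],
                 vector [0, 0, 0, 4 * \<eta> powr (5 / 4)]])"

context thermodynamics
begin

text \<open>With \<open>\<theta> ds = de - (p/\<rho>\<^sup>2) d\<rho>\<close> one gets
  \<open>\<rho>\<theta> ds = dE - u dm + (u\<^sup>2 - E/\<rho> - p/\<rho>) d\<rho>\<close>. The entropy variables are the resulting coefficients; in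
  the proof this is the identity that \<open>J\<^sup>T y\<close> is the gradient of the entropy in \<open>V\<close>.\<close>

lemma entropy_has_derivative:
  assumes "W \<in> cons_domain e"
  defines "V \<equiv> prim_of_cons e W"
  shows "(entropy_fun e s has_derivative (\<lambda>k. entropy_vars e p s V \<bullet> k)) (at W)"
proof -
  have V: "V \<in> prim_domain"
    using assms prim_of_cons_in_prim_domain by simp
  note r = prim_domain_relations[OF V]
  let ?S = "\<lambda>V. - V $ 1 * s (V $ 1) (V $ 3) - 4 / 3 * (V $ 4) powr (3 / 4)"
  have powr: "V $ 4 powr (3 / 4) / V $ 4 = V $ 4 powr (- 1 / 4)"
    using r(3) powr_mult_base[of "V $ 4" "- 1 / 4"] by (simp add: field_simps)
  have "(?S has_derivative (\<lambda>h. - V $ 1 * (D_rho s (V $ 1) (V $ 3) * h $ 1 + D_theta s (V $ 1) (V $ 3) * h $ 3)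
      - h $ 1 * s (V $ 1) (V $ 3) - V $ 4 powr (3 / 4) / V $ 4 * h $ 4)) (at V)"
    using r(3) by (auto intro!: derivative_eq_intros thermo_derivs V simp: field_simps)
  also have "(\<lambda>h. - V $ 1 * (D_rho s (V $ 1) (V $ 3) * h $ 1 + D_theta s (V $ 1) (V $ 3) * h $ 3)
      - h $ 1 * s (V $ 1) (V $ 3) - V $ 4 powr (3 / 4) / V $ 4 * h $ 4)
    = (\<lambda>h. entropy_vars e p s V \<bullet> (cons_jac e V *v h))"
    using r(1,2) unfolding powr r(6-8)
    by (simp add: fun_eq_iff entropy_vars_def cons_jac_def Let_def inner_vec_def sum_4
        matrix_vector_mult_def r(6)) (simp add: field_simps power2_eq_square)
  finally have "(?S has_derivative (\<lambda>h. entropy_vars e p s V \<bullet> (cons_jac e V *v h))) (at V)" .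
  moreover have "entropy_fun e s W = ?S (prim_of_cons e W)" if "W \<in> cons_domain e" for W
    using cons_components[OF that] by (simp add: entropy_fun_def temperature_def Let_def)
  ultimately have "(entropy_fun e s has_derivative (\<lambda>k. entropy_vars e p s V \<bullet> (cons_jac e V *v (prim_jac e V *v k)))) (at W)"
    by (rule has_derivative_via_prim[OF assms(1), folded V_def])
  then show ?thesis
    by (simp only: matrix_vector_mul_assoc cons_jac_prim_jac[OF V] matrix_vector_mul_lid)
qed

lemma entropy_gradient_has_derivative:
  assumes "W \<in> cons_domain e"
  defines "V \<equiv> prim_of_cons e W"
  shows "(gradient (entropy_fun e s) has_derivative
           (*v) (entropy_vars_jac e p V ** prim_jac e V)) (at W)"
proof -
  have V: "V \<in> prim_domain"
    using assms prim_of_cons_in_prim_domain by simp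
  note r = prim_domain_relations[OF V]
  have powr: "V $ 4 powr (- 1 / 4) / V $ 4 = V $ 4 powr (- 5 / 4)"
    using r(3) powr_mult_base[of "V $ 4" "- 5 / 4"] by (simp add: field_simps)
  \<comment> \<open>The right-hand side is what the quotient rule yields. The equality is where the derivatives of \<open>e\<close>
    and \<open>s\<close> are eliminated.\<close>
  have "(\<lambda>h. entropy_vars_jac e p V *v h) = (\<lambda>h. vector [
      ((D_rho e (V $ 1) (V $ 3) * h $ 1 + D_theta e (V $ 1) (V $ 3) * h $ 3
        + ((D_rho p (V $ 1) (V $ 3) * h $ 1 + D_theta p (V $ 1) (V $ 3) * h $ 3) * V $ 1
            - p (V $ 1) (V $ 3) * h $ 1) / (V $ 1 * V $ 1) - V $ 2 * h $ 2) * V $ 3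
        - (e (V $ 1) (V $ 3) + p (V $ 1) (V $ 3) / V $ 1 - (V $ 2)\<^sup>2 / 2) * h $ 3) / (V $ 3 * V $ 3)
        - (D_rho s (V $ 1) (V $ 3) * h $ 1 + D_theta s (V $ 1) (V $ 3) * h $ 3),
      (h $ 2 * V $ 3 - V $ 2 * h $ 3) / (V $ 3 * V $ 3),
      h $ 3 / (V $ 3 * V $ 3),
      V $ 4 powr (- 1 / 4) / V $ 4 * h $ 4 / 4])"
    using r(1,2) unfolding powr r(6-8)
    by (simp add: fun_eq_iff mat_4_simps entropy_vars_jac_def Let_def)
       (simp add: field_simps power2_eq_square)
  then have "(entropy_vars e p s has_derivative (*v) (entropy_vars_jac e p V)) (at V)"
    unfolding entropy_vars_def[abs_def] Let_def using r(1-3)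
    by (auto intro!: has_derivative_vector_4 derivative_eq_intros thermo_derivs V simp: field_simps power2_eq_square)
  moreover have "gradient (entropy_fun e s) W = entropy_vars e p s (prim_of_cons e W)"
    if "W \<in> cons_domain e" for W
    using entropy_has_derivative[OF that] by (rule gradient_eq)
  ultimately have "(gradient (entropy_fun e s) has_derivative (\<lambda>k. entropy_vars_jac e p V *v (prim_jac e V *v k))) (at W)"
    by (rule has_derivative_via_prim[OF assms(1), folded V_def])
  then show ?thesis
    by (simp only: matrix_vector_mul_assoc)
qed

text \<open>The entropy variables diagonalize: \<open>J\<^sup>T D\<^sub>Vy = K\<close>. The only entry that does not vanish for purely
  algebraic reasons is the one of \<open>d\<rho> d\<theta>\<close>, which is
  \<open>p\<^sub>\<theta>/(\<rho>\<theta>) - p/(\<rho>\<theta>\<^sup>2) + \<rho>e\<^sub>\<rho>/\<theta>\<^sup>2\<close>; it is zero by the formula for \<open>e\<^sub>\<rho>\<close>.\<close>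

lemma entropy_vars_jac_factorization:
  assumes "V \<in> prim_domain"
  shows "transpose (cons_jac e V) ** entropy_vars_jac e p V ** entropy_metric_inv e p V = mat 1"
  using prim_domain_relations(1-5)[OF assms]
  by (simp add: mat_4_simps cons_jac_def entropy_vars_jac_def entropy_metric_inv_def Let_def
      prim_domain_relations(6)[OF assms])
     (simp add: field_simps power2_eq_square powr_add[symmetric])

text \<open>\<open>H = D\<^sub>Vy J\<^sup>-\<^sup>1\<close> and \<open>D\<^sub>Vy = J\<^sup>-\<^sup>T K\<close>; the inverse needs no inversion of a full matrix.\<close>

lemma entropy_hessian_right_inverse:
  assumes "W \<in> cons_domain e"
  defines "V \<equiv> prim_of_cons e W"
  shows "hessian (entropy_fun e s) W
           ** (cons_jac e V ** entropy_metric_inv e p V ** transpose (cons_jac e V)) = mat 1"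
proof -
  let ?J = "cons_jac e V" and ?D = "entropy_vars_jac e p V" and ?M = "entropy_metric_inv e p V"
  have V: "V \<in> prim_domain"
    using assms prim_of_cons_in_prim_domain by simp
  have "?D ** ?M ** transpose ?J = mat 1"
    using entropy_vars_jac_factorization[OF V] matrix_left_right_inverse matrix_mul_assoc by metis
  moreover have "hessian (entropy_fun e s) W = ?D ** prim_jac e V"
    unfolding hessian_def using entropy_gradient_has_derivative[OF assms(1)]
    by (simp add: jacobian_eq V_def)
  moreover have "?D ** prim_jac e V ** (?J ** ?M ** transpose ?J)
      = ?D ** (prim_jac e V ** ?J) ** ?M ** transpose ?J"
    by (simp add: matrix_mul_assoc)
  ultimately show ?thesis
    by (simp add: cons_jac_prim_jac[OF V])
qed

lemma entropy_metric_inv_pos_def: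
  assumes "V \<in> prim_domain"
  shows "sym_pos_def (entropy_metric_inv e p V)"
proof -
  let ?\<rho> = "V $ 1" and ?\<theta> = "V $ 3" and ?\<eta> = "V $ 4"
  note r = prim_domain_relations(1-5)[OF assms]
  have "x \<bullet> (entropy_metric_inv e p V *v x) > 0" if "x \<noteq> 0" for x
  proof -
    have "x \<bullet> (entropy_metric_inv e p V *v x) =
        ?\<rho> * ?\<theta> / D_rho p ?\<rho> ?\<theta> * (x $ 1)\<^sup>2 + ?\<theta> / ?\<rho> * (x $ 2)\<^sup>2
        + ?\<theta>\<^sup>2 / (?\<rho> * D_theta e ?\<rho> ?\<theta>) * (x $ 3)\<^sup>2 + 4 * ?\<eta> powr (5 / 4) * (x $ 4)\<^sup>2"
      by (simp add: inner_vec_def sum_4 matrix_vector_mult_def entropy_metric_inv_def Let_def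
          power2_eq_square algebra_simps)
    moreover have "a * c\<^sup>2 \<ge> 0" "a * c\<^sup>2 = 0 \<longleftrightarrow> c = 0" if "a > 0" for a c :: real
      using that by auto
    moreover have "?\<rho> * ?\<theta> / D_rho p ?\<rho> ?\<theta> > 0" "?\<theta> / ?\<rho> > 0"
        "?\<theta>\<^sup>2 / (?\<rho> * D_theta e ?\<rho> ?\<theta>) > 0" "4 * ?\<eta> powr (5 / 4) > 0"
      using r by auto
    moreover have "x $ 1 \<noteq> 0 \<or> x $ 2 \<noteq> 0 \<or> x $ 3 \<noteq> 0 \<or> x $ 4 \<noteq> 0"
      using that by (auto simp: vec_eq_iff forall_4)
    ultimately show ?thesis
      by (smt (verit))
  qed
  moreover have "transpose (entropy_metric_inv e p V) = entropy_metric_inv e p V"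
    by (simp add: vec_eq_iff forall_4 transpose_def entropy_metric_inv_def Let_def)
  ultimately show ?thesis
    by (simp add: sym_pos_def_def)
qed

lemma hessian_inverse_pos_def:
  assumes "W \<in> cons_domain e"
  shows "sym_pos_def (matrix_inv (hessian (entropy_fun e s) W))"
proof -
  note V = prim_of_cons_in_prim_domain[OF assms]
  have "invertible (cons_jac e (prim_of_cons e W))"
    using cons_jac_prim_jac[OF V] invertible_def by blast
  then show ?thesis
    using entropy_metric_inv_pos_def[OF V]
    by (simp add: matrix_inv_eq[OF entropy_hessian_right_inverse[OF assms]] sym_pos_def_congruence)
qed

end

section \<open>Symmetry and positivity of the coefficients\<close>

lemma fourth_power_powr:
  fixes \<theta> :: real
  assumes "\<theta> > 0"
  shows "(\<theta> ^ 4) powr (5 / 4) = \<theta> ^ 5"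
proof -
  have "(\<theta> ^ 4) powr (5 / 4) = (\<theta> powr 4) powr (5 / 4)"
    using assms by simp
  also have "\<dots> = \<theta> powr 5"
    by (simp add: powr_powr)
  finally show ?thesis
    using assms by simp
qed

context thermodynamics
begin

text \<open>With \<open>F\<close> the flux in primitive variables,
  \<open>A\<^sup>1 = (D\<^sub>VF - C J) K\<^sup>-\<^sup>1 J\<^sup>T = u J K\<^sup>-\<^sup>1 J\<^sup>T + R K\<^sup>-\<^sup>1 J\<^sup>T\<close>, where \<open>R = D\<^sub>VF - C J - u J\<close> contains
  the part of the convection that does not move with the fluid. Symmetry of \<open>R K\<^sup>-\<^sup>1 J\<^sup>T\<close> in the entries of
  momentum and energy uses \<open>e\<^sub>\<rho>\<close>, in the entries involving the radiation it uses
  \<open>\<eta>\<^sup>5\<^sup>/\<^sup>4 = \<eta>\<theta>\<close>. The nonconservative term shifts \<open>\<eta>/3\<close> from the energy equation to the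
  radiation equation, which turns the coefficient \<open>\<eta>\<close> of \<open>u\<^sub>x\<close> there into \<open>4\<eta>/3\<close>.\<close>

lemma transport_symmetric:
  assumes W: "W \<in> cons_domain e" and eq: "W $ 4 = temperature e W ^ 4"
  defines "V \<equiv> prim_of_cons e W"
  defines "A \<equiv> (prim_flux_jac e p V ** prim_jac e V - noncons_matrix e W)
                 ** (cons_jac e V ** entropy_metric_inv e p V ** transpose (cons_jac e V))"
  shows "transpose A = A"
proof -
  have V: "V \<in> prim_domain"
    using W prim_of_cons_in_prim_domain by (simp add: V_def)
  note c = cons_components[OF W, folded V_def]
  have V4: "V $ 4 = V $ 3 ^ 4"
    using eq c by (simp add: temperature_def V_def)
  let ?J = "cons_jac e V" and ?M = "entropy_metric_inv e p V" and ?C = "noncons_matrix e W"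
  define R where "R = (prim_flux_jac e p V - ?C ** ?J - V $ 2 *\<^sub>R ?J)"
  have "A = (prim_flux_jac e p V ** (prim_jac e V ** ?J) - ?C ** ?J) ** (?M ** transpose ?J)"
    by (simp add: A_def matrix_mul_assoc matrix_diff_rdistrib)
  also have "\<dots> = R ** ?M ** transpose ?J + V $ 2 *\<^sub>R (?J ** ?M ** transpose ?J)"
    by (simp add: cons_jac_prim_jac[OF V] R_def matrix_mul_assoc matrix_diff_rdistrib matrix_scaleR_left)
  finally have A: "A = R ** ?M ** transpose ?J + V $ 2 *\<^sub>R (?J ** ?M ** transpose ?J)" .
  have R: "R = vector [vector [0, V $ 1, 0, 0],
                 vector [D_rho p (V $ 1) (V $ 3), V $ 1 * V $ 2, D_theta p (V $ 1) (V $ 3), 1 / 3],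
                 vector [V $ 2 * D_rho p (V $ 1) (V $ 3),
                         V $ 1 * (e (V $ 1) (V $ 3) + (V $ 2)\<^sup>2 / 2) + p (V $ 1) (V $ 3),
                         V $ 2 * D_theta p (V $ 1) (V $ 3),
                         V $ 2 / 3],
                 vector [0, 4 * V $ 4 / 3, 0, 0]]"
    using prim_domain_relations(1-5)[OF V]
    by (simp add: R_def mat_4_simps prim_flux_jac_def noncons_matrix_def c velocity_def V_def[symmetric] cons_jac_def Let_def
        field_simps power2_eq_square)
  have "transpose (R ** ?M ** transpose ?J) = R ** ?M ** transpose ?J"
    unfolding R using prim_domain_relations(1-5)[OF V]
    by (simp add: mat_4_simps cons_jac_def entropy_metric_inv_def Let_def prim_domain_relations(6)[OF V]
        fourth_power_powr[OF prim_domain_relations(2)[OF V]] V4)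
      (simp add: field_simps power2_eq_square eval_nat_numeral)
  moreover have "transpose (?J ** ?M ** transpose ?J) = ?J ** ?M ** transpose ?J"
    using entropy_metric_inv_pos_def[OF V]
    by (simp add: sym_pos_def_def matrix_transpose_mul matrix_mul_assoc)
  ultimately show ?thesis
    unfolding A by (simp add: transpose_def vec_eq_iff)
qed

text \<open>The rows of temperature and radiation in \<open>K\<^sup>-\<^sup>1 J\<^sup>T\<close> are \<open>(0, 0, \<theta>\<^sup>2, 0)\<close> and
  \<open>(0, 0, 0, 4\<eta>\<^sup>5\<^sup>/\<^sup>4)\<close>. The exchange term \<open>\<eta> - \<theta>\<^sup>4\<close> thus acts on \<open>Z\<close> by the coefficients
  \<open>-4\<theta>\<^sup>5\<close> and \<open>4\<eta>\<^sup>5\<^sup>/\<^sup>4\<close>, opposite at equilibrium; the quadratic form of \<open>L\<close> is a positive multiple of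
  \<open>(Z\<^sub>3 - Z\<^sub>4)\<^sup>2\<close>.\<close>

lemma relaxation_pos_semidef:
  assumes "V \<in> prim_domain" "V $ 4 = V $ 3 ^ 4" "\<sigma>a > 0"
  shows "sym_pos_semidef (- (prim_source_jac \<sigma>a V ** prim_jac e V)
           ** (cons_jac e V ** entropy_metric_inv e p V ** transpose (cons_jac e V)))"
    (is "sym_pos_semidef ?L")
proof -
  have powr: "V $ 4 powr (5 / 4) = V $ 3 ^ 5"
    using fourth_power_powr[OF prim_domain_relations(2)[OF assms(1)]] by (simp add: assms(2))
  let ?J = "cons_jac e V" and ?M = "entropy_metric_inv e p V" and ?Q = "prim_source_jac \<sigma>a V"
  have "?L = - (?Q ** (prim_jac e V ** ?J)) ** (?M ** transpose ?J)"
    by (simp add: matrix_mul_assoc matrix_minus_left)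
  also have "\<dots> = - ?Q ** (?M ** transpose ?J)"
    by (simp add: cons_jac_prim_jac[OF assms(1)])
  also have "\<dots> = (4 * \<sigma>a * V $ 3 ^ 5) *\<^sub>R vector [vector [0, 0, 0, 0], vector [0, 0, 0, 0],
      vector [0, 0, 1, - 1], vector [0, 0, - 1, 1]]"
    using prim_domain_relations(1-5)[OF assms(1)]
    by (simp add: mat_4_simps prim_source_jac_def cons_jac_def entropy_metric_inv_def Let_def
        powr field_simps eval_nat_numeral)
  finally have L: "?L = \<dots>" .
  have "x \<bullet> (?L *v x) = 4 * \<sigma>a * V $ 3 ^ 5 * (x $ 3 - x $ 4)\<^sup>2" for x
    unfolding L by (simp add: inner_vec_def sum_4 matrix_vector_mult_def power2_eq_square algebra_simps)
  moreover have "transpose ?L = ?L"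
    unfolding L by (simp add: transpose_def vec_eq_iff forall_4)
  ultimately show ?thesis
    using prim_domain_relations(2)[OF assms(1)] assms(3) by (simp add: sym_pos_semidef_def)
qed

text \<open>The last row and the last column of \<open>J\<close> are unit vectors, so \<open>A\<^sup>0\<close> couples the radiation energy to nothing else.\<close>

lemma diffusion_pos_semidef:
  assumes "V \<in> prim_domain" "\<sigma>s > 0"
  shows "sym_pos_semidef (diffusion_matrix \<sigma>s
           ** (cons_jac e V ** entropy_metric_inv e p V ** transpose (cons_jac e V)))"
    (is "sym_pos_semidef ?B")
proof -
  have B: "?B = (4 * V $ 4 powr (5 / 4) / (3 * \<sigma>s)) *\<^sub>R vector [vector [0, 0, 0, 0],
      vector [0, 0, 0, 0], vector [0, 0, 0, 0], vector [0, 0, 0, 1]]"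
    by (simp add: mat_4_simps diffusion_matrix_def cons_jac_def entropy_metric_inv_def Let_def)
  have "x \<bullet> (?B *v x) = 4 * V $ 4 powr (5 / 4) / (3 * \<sigma>s) * (x $ 4)\<^sup>2" for x
    unfolding B by (simp add: inner_vec_def sum_4 matrix_vector_mult_def power2_eq_square algebra_simps)
  moreover have "transpose ?B = ?B"
    unfolding B by (simp add: transpose_def vec_eq_iff forall_4)
  ultimately show ?thesis
    using assms(2) by (simp add: sym_pos_semidef_def)
qed

end

section \<open>The symmetrizer\<close>

theorem proposition3p5:
  fixes p e s :: "real \<Rightarrow> real \<Rightarrow> real"
    and \<sigma>a \<sigma>s :: real
    and Wb :: "real ^ 4"
    and H A0 A1 L B :: "real ^ 4 ^ 4"
  assumes p_smooth: "C_infinity_on (\<lambda>(\<rho>, \<theta>). p \<rho> \<theta>) thermo_domain"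
    and e_smooth: "C_infinity_on (\<lambda>(\<rho>, \<theta>). e \<rho> \<theta>) thermo_domain"
    and s_smooth: "C_infinity_on (\<lambda>(\<rho>, \<theta>). s \<rho> \<theta>) thermo_domain"
    and p_pos: "\<And>\<rho> \<theta>. (\<rho>, \<theta>) \<in> thermo_domain \<Longrightarrow> p \<rho> \<theta> > 0"
    and p_rho_pos: "\<And>\<rho> \<theta>. (\<rho>, \<theta>) \<in> thermo_domain \<Longrightarrow> D_rho p \<rho> \<theta> > 0"
    and p_theta_pos: "\<And>\<rho> \<theta>. (\<rho>, \<theta>) \<in> thermo_domain \<Longrightarrow> D_theta p \<rho> \<theta> > 0"
    and e_theta_pos: "\<And>\<rho> \<theta>. (\<rho>, \<theta>) \<in> thermo_domain \<Longrightarrow> D_theta e \<rho> \<theta> > 0"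
    and e_rho: "\<And>\<rho> \<theta>. (\<rho>, \<theta>) \<in> thermo_domain \<Longrightarrow>
                  D_rho e \<rho> \<theta> = (p \<rho> \<theta> - \<theta> * D_theta p \<rho> \<theta>) / \<rho>\<^sup>2"
    and s_rho: "\<And>\<rho> \<theta>. (\<rho>, \<theta>) \<in> thermo_domain \<Longrightarrow> D_rho s \<rho> \<theta> = - D_theta p \<rho> \<theta> / \<rho>\<^sup>2"
    and s_theta: "\<And>\<rho> \<theta>. (\<rho>, \<theta>) \<in> thermo_domain \<Longrightarrow> D_theta s \<rho> \<theta> = D_theta e \<rho> \<theta> / \<theta>"
    and sigma_pos: "\<sigma>a > 0" "\<sigma>s > 0"
    and state: "Wb \<in> cons_domain e"
    and equilibrium: "Wb $ 4 = temperature e Wb ^ 4"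
    and H_eq: "H = hessian (entropy_fun e s) Wb"
    and A0_eq: "A0 = matrix_inv H"
    and A1_eq: "A1 = (jacobian (flux e p) (at Wb) - noncons_matrix e Wb) ** matrix_inv H"
    and L_eq: "L = - jacobian (source e \<sigma>a) (at Wb) ** matrix_inv H"
    and B_eq: "B = diffusion_matrix \<sigma>s ** matrix_inv H"
  shows
    "\<comment> \<open>all derivatives occurring in the matrices exist, and so does the inverse of the Hessian\<close>
     (\<forall>W\<in>cons_domain e. entropy_fun e s differentiable (at W)) \<and>
     gradient (entropy_fun e s) differentiable (at Wb) \<and>
     flux e p differentiable (at Wb) \<and> source e \<sigma>a differentiable (at Wb) \<and>
     invertible H \<and>
     \<comment> \<open>the linearized system in the variable \<open>Z\<close>\<close>
     (\<forall>W Z \<Omega>. open \<Omega> \<and> Ck_on 2 (\<lambda>(t, x). W t x) \<Omega> \<and> Z = (\<lambda>t x. H *v (W t x - Wb)) \<longrightarrow>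
       (\<forall>(t, x)\<in>\<Omega>.
          linearization_value
            (system_residual (flux e p) (diffusion_matrix \<sigma>s) (noncons_matrix e) (source e \<sigma>a))
            Wb (\<lambda>t x. W t x - Wb) t x
            (A0 *v Dt Z t x + A1 *v Dx Z t x + L *v Z t x - B *v Dx (Dx Z) t x)) \<and>
       ((\<forall>(t, x)\<in>\<Omega>.
          linearization_value
            (system_residual (flux e p) (diffusion_matrix \<sigma>s) (noncons_matrix e) (source e \<sigma>a))
            Wb (\<lambda>t x. W t x - Wb) t x 0) \<longleftrightarrow>
        (\<forall>(t, x)\<in>\<Omega>. A0 *v Dt Z t x + A1 *v Dx Z t x + L *v Z t x = B *v Dx (Dx Z) t x))) \<and>
     \<comment> \<open>the structure of its coefficients\<close>
     sym_pos_def A0 \<and> transpose A1 = A1 \<and> sym_pos_semidef L \<and> sym_pos_semidef B"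
proof -
  interpret thermodynamics p e s
    using p_smooth e_smooth s_smooth p_rho_pos e_theta_pos e_rho s_rho s_theta
    by unfold_locales (simp_all only: C_infinity_on_def)
  define V where "V = prim_of_cons e Wb"
  define S where "S = cons_jac e V ** entropy_metric_inv e p V ** transpose (cons_jac e V)"
  have V: "V \<in> prim_domain"
    using state prim_of_cons_in_prim_domain by (simp add: V_def)
  have V4: "V $ 4 = V $ 3 ^ 4"
    using equilibrium cons_components(3)[OF state] by (simp add: temperature_def V_def)
  define Df where "Df W = prim_flux_jac e p (prim_of_cons e W) ** prim_jac e (prim_of_cons e W)" for W
  define DQ where "DQ = prim_source_jac \<sigma>a V ** prim_jac e V"
  note f = flux_has_derivative[folded Df_def]
  note Q = source_has_derivative[OF state, of \<sigma>a, folded V_def, folded DQ_def]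
  have HS: "H ** S = mat 1"
    using entropy_hessian_right_inverse[OF state] by (simp add: H_eq S_def V_def)
  then have SH: "S ** H = mat 1"
    using matrix_left_right_inverse by blast
  note H = matrix_inv_eq[OF HS]
  have coeffs: "A0 = S" "A1 = (Df Wb - noncons_matrix e Wb) ** S" "L = - DQ ** S"
      "B = diffusion_matrix \<sigma>s ** S"
    using A0_eq A1_eq L_eq B_eq H(2) jacobian_eq[OF f[OF state]] jacobian_eq[OF Q] by simp_all
  note lin = linearization_in_transformed_variable[OF open_cons_domain state f
      isCont_flux_jacobian[OF state, folded Df_def] isCont_noncons_matrix[OF state] Q SH,
      where G = "diffusion_matrix \<sigma>s", folded coeffs]
  have linear_system: "(\<forall>(t, x)\<in>\<Omega>.
          linearization_value
            (system_residual (flux e p) (diffusion_matrix \<sigma>s) (noncons_matrix e) (source e \<sigma>a))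
            Wb (\<lambda>t x. W t x - Wb) t x
            (A0 *v Dt Z t x + A1 *v Dx Z t x + L *v Z t x - B *v Dx (Dx Z) t x)) \<and>
       ((\<forall>(t, x)\<in>\<Omega>.
          linearization_value
            (system_residual (flux e p) (diffusion_matrix \<sigma>s) (noncons_matrix e) (source e \<sigma>a))
            Wb (\<lambda>t x. W t x - Wb) t x 0) \<longleftrightarrow>
        (\<forall>(t, x)\<in>\<Omega>. A0 *v Dt Z t x + A1 *v Dx Z t x + L *v Z t x = B *v Dx (Dx Z) t x))"
    (is "(\<forall>(t, x)\<in>\<Omega>. ?lin t x (?R t x - ?D t x)) \<and> _")
    if "open \<Omega>" "Ck_on 2 (\<lambda>(t, x). W t x) \<Omega>" "Z = (\<lambda>t x. H *v (W t x - Wb))" for W Z \<Omega>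
  proof -
    have *: "?lin t x (?R t x - ?D t x)" if "(t, x) \<in> \<Omega>" for t x
      unfolding \<open>Z = _\<close> by (rule lin[OF _ \<open>Ck_on 2 _ \<Omega>\<close> \<open>open \<Omega>\<close> that])
    have "?lin t x 0 \<longleftrightarrow> ?R t x = ?D t x" if "(t, x) \<in> \<Omega>" for t x
      using *[OF that] linearization_value_unique[OF *[OF that], of 0] by auto
    with * show ?thesis
      by blast
  qed
  show ?thesis
  proof (intro conjI)
    show "\<forall>W\<in>cons_domain e. entropy_fun e s differentiable (at W)"
      using entropy_has_derivative by (blast intro: differentiableI)
    show "gradient (entropy_fun e s) differentiable (at Wb)"
      using entropy_gradient_has_derivative[OF state] by (rule differentiableI)
    show "flux e p differentiable (at Wb)"
      using f[OF state] by (rule differentiableI)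
    show "source e \<sigma>a differentiable (at Wb)"
      using Q by (rule differentiableI)
    show "invertible H"
      by (rule H)
    show "sym_pos_def A0"
      using hessian_inverse_pos_def[OF state] by (simp add: A0_eq H_eq)
    show "transpose A1 = A1"
      using transport_symmetric[OF state equilibrium] by (simp add: coeffs Df_def S_def V_def)
    show "sym_pos_semidef L"
      using relaxation_pos_semidef[OF V V4 sigma_pos(1)] by (simp add: coeffs DQ_def S_def)
    show "sym_pos_semidef B"
      using diffusion_pos_semidef[OF V sigma_pos(2)] by (simp add: coeffs S_def)
  qed (use linear_system in blast)
qed

end
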